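(* Let $g$ be a totally positive function of Gaussian type. Let $f=\sum_{k\in\mathbb{Z}}c_k g(\cdot-k)$ with coefficients $c\in\ell^\infty(\mathbb{Z})$, and let $N(f)=\{x\in\mathbb{R}:f(x)=0\}$ be the zero set of $f$. Then either $D^-(N(f))\le 1$ or $f\equiv 0$.
   Context: Fourier transform: $\hat f(\xi)=\int_{\mathbb{R}} f(x)e^{-2\pi i x\xi}\,dx$. A function $g$ on $\mathbb{R}$ is called totally positive of Gaussian type if its Fourier transform factors as $\hat g(\xi)=\prod_{j=1}^n(1+2\pi i\delta_j\xi)^{-1}e^{-c\xi^2}$ for some $n\in\mathbb{N}\cup\{0\}$, $\delta_1,\dots,\delta_n\in\mathbb{R}$ and $c>0$. Lower Beurling density of a set $\Lambda\subseteq\mathbb{R}$: $D^-(\Lambda)=\liminf_{R\to\infty}\inf_{x\in\mathbb{R}}\frac{\#(\Lambda\cap[x-R,x+R])}{2R}\in[0,\infty]$. *)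

theory Defs
  imports "HOL-Analysis.Analysis"
begin

definition fourier_transform :: "(real \<Rightarrow> complex) \<Rightarrow> real \<Rightarrow> complex" where
  "fourier_transform f \<xi> =
     (LINT x|lborel. f x * exp (- (2 * of_real pi * \<i> * of_real x * of_real \<xi>)))"

text \<open>
  The Fourier transform determines an integrable function only up to null sets, whereas zero sets
  depend on point values; as usual, \<open>g\<close> denotes the continuous representative. (Since \<open>\<delta>\<close> is real,
  \<open>g\<close> is automatically real-valued.)
\<close>

definition totally_positive_gaussian_type :: "(real \<Rightarrow> complex) \<Rightarrow> bool" where
  "totally_positive_gaussian_type g \<longleftrightarrow>
     continuous_on UNIV g \<and> integrable lborel g \<and>
     (\<exists>(n::nat) (\<delta>::nat \<Rightarrow> real) (c::real). c > 0 \<and>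
        (\<forall>\<xi>::real. fourier_transform g \<xi> =
           (\<Prod>j=1..n. inverse (1 + 2 * of_real pi * \<i> * of_real (\<delta> j) * of_real \<xi>))
             * of_real (exp (- c * \<xi>\<^sup>2))))"

text \<open>
  Counting measure takes the value \<open>\<infinity>\<close> on infinite sets, unlike \<^const>\<open>card\<close>.
\<close>

definition lower_beurling_density :: "real set \<Rightarrow> ennreal" where
  "lower_beurling_density \<Lambda> =
     Liminf at_top (\<lambda>R::real. INF x::real.
       emeasure (count_space UNIV) (\<Lambda> \<inter> {x - R..x + R}) / ennreal (2 * R))"

text \<open>
  For \<open>g\<close> of Gaussian type and bounded \<open>c\<close> the series converges absolutely at every point, because
  \<open>g\<close> decays exponentially; hence the default value of \<^const>\<open>infsum\<close> plays no role.
\<close>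

definition shift_series :: "(real \<Rightarrow> complex) \<Rightarrow> (int \<Rightarrow> complex) \<Rightarrow> real \<Rightarrow> complex" where
  "shift_series g c x = (\<Sum>\<^sub>\<infinity>k::int. c k * g (x - of_int k))"

end

theory Submission
  imports Defs "HOL-Probability.Probability" "HOL-Complex_Analysis.Complex_Analysis"
    "HOL-Real_Asymp.Real_Asymp" "HOL-Library.Nat_Bijection"
begin

text \<open>
  A factor \<open>(1 + 2\<pi>i\<delta>\<xi>)\<^sup>-\<^sup>1\<close> of the Fourier transform is averaging of the translates
  \<open>h (x - \<delta>u)\<close> over an exponentially distributed \<open>u\<close>. So \<open>g\<close> is a normal density averaged
  \<open>n\<close> times, and \<open>f\<close> arises in the same way from a series of shifted Gaussians with the same
  coefficients; these may be taken real, since \<open>g\<close> is real. If \<open>Th\<close> is the average of \<open>h\<close>, then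
  \<open>(exp (x/\<delta>) Th)' = exp (x/\<delta>) h/\<delta>\<close>, so by Rolle's theorem undoing one averaging loses at most one
  zero per interval. Density above \<open>1\<close> thus passes down to the
  Gaussian series, which is \<open>exp (- \<gamma>x\<^sup>2) F (exp (2\<gamma>x))\<close> with \<open>F\<close> holomorphic on the punctured plane
  and \<open>norm (F w) \<le> C exp (\<gamma>x\<^sup>2)\<close> for \<open>norm w = exp (2\<gamma>x)\<close>. Dividing \<open>F\<close> by a finite product over its
  zeros in a large annulus, the maximum modulus principle forces \<open>F = 0\<close>, because density above
  \<open>1\<close> makes the product larger than \<open>F\<close> on both boundary circles.
\<close>

section \<open>Zeros of holomorphic functions on the punctured plane\<close>

text \<open>Dividing by a linear factor leaves a removable singularity, so the zeros can be split
  off one at a time. As \<open>\<zeta>\<close> is injective on \<open>I\<close>, each quotient still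
  vanishes at the remaining points. The zero-free functions \<open>u i\<close> make room for
  normalized factors such as \<open>1 - w / a\<close>.\<close>

lemma holomorphic_factor_simple_zeros:
  fixes F :: "complex \<Rightarrow> complex" and \<zeta> :: "'a \<Rightarrow> complex" and u :: "'a \<Rightarrow> complex \<Rightarrow> complex"
  assumes "finite I" "open S" "F holomorphic_on S" "inj_on \<zeta> I" "\<zeta> ` I \<subseteq> S"
    and "\<And>i. i \<in> I \<Longrightarrow> F (\<zeta> i) = 0"
    and "\<And>i. i \<in> I \<Longrightarrow> u i holomorphic_on S"
    and "\<And>i w. i \<in> I \<Longrightarrow> w \<in> S \<Longrightarrow> u i w \<noteq> 0"
  shows "\<exists>H. H holomorphic_on S \<and> (\<forall>w\<in>S. F w = H w * (\<Prod>i\<in>I. (w - \<zeta> i) * u i w))"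
  using assms
proof (induction I arbitrary: F rule: finite_induct)
  case empty
  then show ?case by auto
next
  case (insert j I)
  \<comment> \<open>The derivative is the value that removes the singularity of the quotient at
    \<open>\<zeta> j\<close>.\<close>
  define F1 where "F1 = (\<lambda>w. if w = \<zeta> j then deriv F (\<zeta> j) else F w / (w - \<zeta> j))"
  have F1: "F1 holomorphic_on S"
  proof (rule pole_theorem_open_0[of F S "\<zeta> j"])
    show "F holomorphic_on S" "open S" "F (\<zeta> j) = 0"
      using insert.prems(1,2,5) by auto
  qed (simp_all add: F1_def)
  define G where "G = (\<lambda>w. F1 w / u j w)"
  have "G holomorphic_on S"
    unfolding G_def using insert.prems(6,7) by (intro holomorphic_intros F1) simp_all
  moreover have "G (\<zeta> i) = 0" if "i \<in> I" for i
  proof -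
    have "\<zeta> i \<noteq> \<zeta> j"
      using that insert.hyps insert.prems(3) by (auto simp: inj_on_def)
    then show ?thesis
      using that insert.prems(5) by (simp add: G_def F1_def)
  qed
  ultimately have "\<exists>H. H holomorphic_on S \<and> (\<forall>w\<in>S. G w = H w * (\<Prod>i\<in>I. (w - \<zeta> i) * u i w))"
    using insert.prems(1,3,4,6,7) by (intro insert.IH) simp_all
  then obtain H where H: "H holomorphic_on S"
    "\<And>w. w \<in> S \<Longrightarrow> G w = H w * (\<Prod>i\<in>I. (w - \<zeta> i) * u i w)"
    by auto
  have "F w = H w * (\<Prod>i\<in>insert j I. (w - \<zeta> i) * u i w)" if "w \<in> S" for w
  proof -
    have "F w = G w * ((w - \<zeta> j) * u j w)"
      using insert.prems(5,7)[of j] that by (simp add: G_def F1_def)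
    then show ?thesis
      using H(2)[OF that] insert.hyps by (simp add: mult_ac)
  qed
  with H(1) show ?case by blast
qed

section \<open>Bounds for finite products, uniform in the number of factors\<close>

lemma sum_geometric_le:
  fixes t :: real
  assumes "0 \<le> t" "t < 1"
  shows "(\<Sum>i<N. t ^ i) \<le> 1 / (1 - t)"
proof -
  have "(\<Sum>i<N. t ^ i) \<le> (\<Sum>i. t ^ i)"
    using assms by (intro sum_le_suminf summable_geometric) auto
  then show ?thesis
    using assms by (simp add: suminf_geometric)
qed

lemma prod_one_plus_geometric_le:
  fixes t K :: real
  assumes "0 \<le> t" "t < 1" "0 \<le> K"
  shows "(\<Prod>i<N. 1 + K * t ^ i) \<le> exp (K / (1 - t))"
proof -
  have "(\<Prod>i<N. 1 + K * t ^ i) \<le> (\<Prod>i<N. exp (K * t ^ i))"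
    using assms by (intro prod_mono) (auto intro: add_nonneg_nonneg)
  also have "\<dots> = exp (K * (\<Sum>i<N. t ^ i))"
    by (simp add: exp_sum sum_distrib_left)
  also have "\<dots> \<le> exp (K / (1 - t))"
    using mult_left_mono[OF sum_geometric_le[OF assms(1,2)] assms(3)] by simp
  finally show ?thesis .
qed

text \<open>For \<open>s = t ^ Suc i\<close>, the inequality
  \<open>1 / (1 - s) = 1 + s / (1 - s) \<le> exp (s / (1 - s))\<close> bounds each factor below by
  an exponential. The exponents are dominated by a geometric series, which accounts for the second
  power of \<open>1 - t\<close>.\<close>

lemma prod_one_minus_geometric_ge:
  fixes t :: real
  assumes "0 \<le> t" "t < 1"
  shows "exp (- 1 / (1 - t)\<^sup>2) \<le> (\<Prod>i<N. 1 - t ^ Suc i)"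
proof -
  have "exp (- 1 / (1 - t)\<^sup>2) \<le> exp (- (1 / (1 - t)) * (\<Sum>i<N. t ^ i))"
    using mult_left_mono[OF sum_geometric_le[OF assms, of N], of "1 / (1 - t)"] assms
    by (simp add: power2_eq_square)
  also have "\<dots> = (\<Prod>i<N. exp (- (t ^ i / (1 - t))))"
    by (simp add: exp_sum[symmetric] sum_distrib_left sum_negf)
  also have "\<dots> \<le> (\<Prod>i<N. 1 - t ^ Suc i)"
  proof (intro prod_mono conjI)
    fix i
    define s where "s = t ^ Suc i"
    have s: "0 \<le> s" "s \<le> t" "s \<le> t ^ i"
      using assms power_le_one[of t i] by (auto simp: s_def mult_left_le mult_left_le_one_le)
    have "1 / (1 - s) = 1 + s / (1 - s)"
      using s assms by (simp add: field_simps)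
    also have "\<dots> \<le> exp (s / (1 - s))" by (rule exp_ge_add_one_self)
    also have "\<dots> \<le> exp (t ^ i / (1 - t))"
      using s assms by (simp, intro frac_le) auto
    finally show "exp (- (t ^ i / (1 - t))) \<le> 1 - t ^ Suc i"
      using s assms unfolding s_def[symmetric] by (simp add: exp_minus field_simps)
  qed auto
  finally show ?thesis .
qed

lemma norm_one_minus_ge:
  fixes z :: complex
  shows "norm z - 1 \<le> norm (1 - z)" "1 - norm z \<le> norm (1 - z)"
  using norm_triangle_ineq2[of z 1] norm_triangle_ineq2[of 1 z] by (auto simp: norm_minus_commute)

lemma power_card_le_prod:
  fixes f :: "'a \<Rightarrow> real"
  assumes "\<And>x. x \<in> A \<Longrightarrow> c \<le> f x" "0 \<le> c"
  shows "c ^ card A \<le> prod f A"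
  using prod_mono[of A "\<lambda>_. c" f] assms by simp

lemma prod_le_power_card:
  fixes f :: "'a \<Rightarrow> real"
  assumes "\<And>x. x \<in> A \<Longrightarrow> f x \<le> c" "\<And>x. x \<in> A \<Longrightarrow> 0 \<le> f x"
  shows "prod f A \<le> c ^ card A"
  using prod_mono[of A f "\<lambda>_. c"] assms by simp

text \<open>A Jensen-type argument in the logarithmic variable \<open>x\<close>. With
  \<open>N\<close> windows on each side of 0, the product over the zeros is, to leading order in the
  exponent, at least \<open>exp (\<gamma> * L * m * N\<^sup>2)\<close> on two circles where
  \<open>F\<close> is at most \<open>exp (\<gamma> * L\<^sup>2 * N\<^sup>2)\<close>. Since
  \<open>L < m\<close>, the quotient tends to 0 at \<open>w0\<close> as \<open>N\<close> grows,
  while the product stays bounded there.\<close>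

lemma holomorphic_zero_if_many_zeros:
  fixes F :: "complex \<Rightarrow> complex" and \<gamma> C L :: real and m :: nat
  assumes hol: "F holomorphic_on - {0}" and \<gamma>: "\<gamma> > 0" and L: "0 < L" "L < m"
    and growth: "\<And>x w. norm w = exp (2 * \<gamma> * x) \<Longrightarrow> norm (F w) \<le> C * exp (\<gamma> * x\<^sup>2)"
    and Z: "\<And>k::int. finite (Z k)" "\<And>k. card (Z k) = m" "\<And>k. Z k \<subseteq> {k * L..<(k + 1) * L}"
      "\<And>k x. x \<in> Z k \<Longrightarrow> F (of_real (exp (2 * \<gamma> * x))) = 0"
    and "w0 \<noteq> 0"
  shows "F w0 = 0"
proof -
  \<comment> \<open>Moving \<open>x\<close> by one window length \<open>L\<close> multiplies the
    radius by \<open>Q\<close>; all estimates become powers of \<open>Q\<close> or of its inverse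
    \<open>t\<close>.\<close>
  define Q where "Q = exp (2 * \<gamma> * L)"
  define t where "t = 1 / Q"
  have Q: "Q > 1" using \<gamma> L by (simp add: Q_def)
  then have t: "0 < t" "t < 1" by (auto simp: t_def)
  have Qpow: "Q ^ n = exp (2 * \<gamma> * (n * L))" for n
    by (simp add: Q_def exp_of_nat_mult[symmetric] mult_ac)
  have tpow: "t ^ n = exp (- 2 * \<gamma> * (n * L))" for n
    by (simp add: t_def power_divide Qpow exp_minus inverse_eq_divide)
  \<comment> \<open>Normalized so that the products over all zeros with \<open>\<bar>x\<bar> \<le> N L\<close> stay bounded at \<open>w0\<close>
    as \<open>N\<close> grows.\<close>
  define p :: "real \<Rightarrow> complex \<Rightarrow> complex" where "p = (\<lambda>x w. if x \<ge> 0 then 1 - w / of_real (exp (2 * \<gamma> * x))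
                                else 1 - of_real (exp (2 * \<gamma> * x)) / w)"
  \<comment> \<open>The zero-free cofactor that turns \<open>w - exp (2 * \<gamma> * x)\<close> into
    the normalized factor \<open>p x w\<close>.\<close>
  define u :: "real \<Rightarrow> complex \<Rightarrow> complex" where "u = (\<lambda>x w. if x \<ge> 0 then - 1 / of_real (exp (2 * \<gamma> * x)) else 1 / w)"
  have p_u: "p x w = (w - of_real (exp (2 * \<gamma> * x))) * u x w" if "w \<noteq> 0" for x w
    using that by (auto simp: p_def u_def field_simps)
  \<comment> \<open>\<open>Yp i\<close> is taken from the window starting at \<open>i * L\<close>,
    and \<open>Yn i\<close> from its mirror image, which starts at \<open>- (i + 1) * L\<close>;
    hence the index \<open>- int i - 1\<close>.\<close>
  define Yp where "Yp = (\<lambda>i::nat. Z (int i))"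
  define Yn where "Yn = (\<lambda>i::nat. Z (- int i - 1))"
  have Yp: "real i * L \<le> x" "x < (real i + 1) * L" "0 \<le> x" if "x \<in> Yp i" for i x
  proof -
    show 1: "real i * L \<le> x" "x < (real i + 1) * L"
      using that Z(3)[of "int i"] by (auto simp: Yp_def add.commute)
    have "0 \<le> real i * L" using L by simp
    with 1 show "0 \<le> x" by linarith
  qed
  have Yn: "- (real i + 1) * L \<le> x" "x < - real i * L" "x < 0" if "x \<in> Yn i" for i x
  proof -
    show 1: "- (real i + 1) * L \<le> x" "x < - real i * L"
      using that Z(3)[of "- int i - 1"] by (auto simp: Yn_def algebra_simps)
    have "0 \<le> real i * L" using L by simp
    with 1 show "x < 0" by simp
  qed
  have Y: "finite (Yp i)" "finite (Yn i)" "card (Yp i) = m" "card (Yn i) = m" "Yp i \<inter> Yn i = {}" for i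
    using Z(1,2) Yp(3)[of _ i] Yn(3)[of _ i] by (force simp: Yp_def Yn_def)+
  have mono: "exp (2 * \<gamma> * a) \<le> exp (2 * \<gamma> * b)" if "a \<le> b" for a b :: real
    using that \<gamma> by simp
  define Y where "Y = (\<lambda>i. Yp i \<union> Yn i)"
  have disj: "Y i \<inter> Y j = {}" if "i < j" for i j
  proof -
    have "(i + 1) * L \<le> j * L"
      using that L by (intro mult_right_mono) auto
    then have "x \<notin> Y j" if "x \<in> Y i" for x
      using that Yp[of x i] Yn[of x i] Yp[of x j] Yn[of x j] by (auto simp: Y_def algebra_simps)
    then show ?thesis by blast
  qed
  have prod_Y: "(\<Prod>x\<in>(\<Union>i<N. Y i). f x) = (\<Prod>i<N. prod f (Yp i) * prod f (Yn i))"
    for f :: "real \<Rightarrow> real" and N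
  proof -
    have "(\<Prod>x\<in>(\<Union>i<N. Y i). f x) = (\<Prod>i<N. prod f (Y i))"
    proof (rule prod.UNION_disjoint)
      show "\<forall>i\<in>{..<N}. \<forall>j\<in>{..<N}. i \<noteq> j \<longrightarrow> Y i \<inter> Y j = {}"
        using disj by (metis Int_commute nat_neq_iff)
    qed (use Y(1,2) in \<open>simp_all add: Y_def\<close>)
    also have "\<dots> = (\<Prod>i<N. prod f (Yp i) * prod f (Yn i))"
      unfolding Y_def using Y by (simp add: prod.union_disjoint)
    finally show ?thesis .
  qed
  have finY: "finite (\<Union>i<N. Y i)" for N
    using Y by (simp add: Y_def)

  \<comment> \<open>Dominates both \<open>norm w0\<close> and \<open>1 / norm w0\<close>, so that
    one estimate serves the factors of either sign of \<open>x\<close>.\<close>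
  define K where "K = norm w0 + 1 / norm w0"
  have K: "0 \<le> K" by (simp add: K_def)
  \<comment> \<open>Bounds the product of \<open>1 + K * t ^ i\<close> for every number of factors.
    It enters with the power \<open>2 * m\<close>, as each \<open>i\<close> contributes
    \<open>m\<close> zeros on either side.\<close>
  define E where "E = exp (K / (1 - t))"
  have upper: "norm (\<Prod>x\<in>(\<Union>i<N. Y i). p x w0) \<le> E ^ (2 * m)" for N
  proof -
    have "norm (p x w0) \<le> 1 + K * t ^ i" if "x \<in> Yp i \<union> Yn i" for x i
    proof (cases "x \<in> Yp i")
      case True
      have "norm (p x w0) \<le> 1 + norm w0 * exp (2 * \<gamma> * (- x))"
        using Yp(3)[OF True] norm_triangle_ineq4[of 1 "w0 / of_real (exp (2 * \<gamma> * x))"]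
        by (simp add: p_def divide_inverse norm_mult norm_inverse exp_minus)
      also have "\<dots> \<le> 1 + K * t ^ i"
      proof (intro add_left_mono mult_mono)
        show "exp (2 * \<gamma> * (- x)) \<le> t ^ i"
          using mono[of "- x" "- (i * L)"] Yp(1)[OF True] by (simp add: tpow)
      qed (use K in \<open>auto simp: K_def\<close>)
      finally show ?thesis .
    next
      case False
      with that have x: "x \<in> Yn i" by simp
      have "norm (p x w0) \<le> 1 + 1 / norm w0 * exp (2 * \<gamma> * x)"
        using Yn(3)[OF x] norm_triangle_ineq4[of 1 "of_real (exp (2 * \<gamma> * x)) / w0"]
        by (simp add: p_def norm_divide)
      also have "\<dots> \<le> 1 + K * t ^ i"
      proof (intro add_left_mono mult_mono)
        show "exp (2 * \<gamma> * x) \<le> t ^ i"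
          using mono[of x "- (i * L)"] Yn(2)[OF x] by (simp add: tpow)
      qed (use K in \<open>auto simp: K_def\<close>)
      finally show ?thesis .
    qed
    then have 1: "(\<Prod>x\<in>Yp i. norm (p x w0)) \<le> (1 + K * t ^ i) ^ m"
         "(\<Prod>x\<in>Yn i. norm (p x w0)) \<le> (1 + K * t ^ i) ^ m" for i
      using prod_le_power_card[of "Yp i" "\<lambda>x. norm (p x w0)"] prod_le_power_card[of "Yn i" "\<lambda>x. norm (p x w0)"] Y
      by auto
    have "norm (\<Prod>x\<in>(\<Union>i<N. Y i). p x w0) = (\<Prod>i<N. (\<Prod>x\<in>Yp i. norm (p x w0)) * (\<Prod>x\<in>Yn i. norm (p x w0)))"
      unfolding prod_norm[symmetric] by (rule prod_Y)
    also have "\<dots> \<le> (\<Prod>i<N. (1 + K * t ^ i) ^ (2 * m))"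
      using K t by (intro prod_mono conjI mult_nonneg_nonneg prod_nonneg)
                   (auto simp: mult_2 power_add intro!: mult_mono 1 prod_nonneg)
    also have "\<dots> = (\<Prod>i<N. 1 + K * t ^ i) ^ (2 * m)"
      by (simp add: prod_power_distrib)
    also have "\<dots> \<le> E ^ (2 * m)"
      unfolding E_def using K t
      by (intro power_mono prod_one_plus_geometric_le prod_nonneg) auto
    finally show ?thesis .
  qed

  define \<kappa> where "\<kappa> = exp (- 1 / (1 - t)\<^sup>2)"
  have \<kappa>: "0 < \<kappa>" by (simp add: \<kappa>_def)
  \<comment> \<open>The zeros in use satisfy \<open>\<bar>x\<bar> \<le> N * L\<close>; the boundary
    circles lie one further window out, which keeps every factor away from 0 there.\<close>
  define R where "R = (\<lambda>N::nat. (real N + 1) * L)"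
  have lower: "exp (\<gamma> * L * m * N * (real N + 1)) * \<kappa> ^ (2 * m) \<le> norm (\<Prod>x\<in>(\<Union>i<N. Y i). p x w)"
    if w: "norm w = exp (2 * \<gamma> * R N) \<or> norm w = exp (2 * \<gamma> * (- R N))" for N w
  proof -
    have w0: "w \<noteq> 0" using w by auto
    define q where "q = (\<lambda>i. Q ^ Suc i)"
    have q: "1 \<le> q i" for i
      using Q unfolding q_def by (intro one_le_power) auto
    have tq: "1 / q i = t ^ Suc i" for i
      by (simp add: q_def t_def power_divide)
    \<comment> \<open>The zeros of the \<open>i\<close>-th window on the side of the circle are at
      distance at least \<open>(N - i) * L\<close> from it, and
      \<open>q (N - Suc i) = Q ^ (N - i)\<close>. With \<open>r\<close> for this power, a factor on
      that side is at least \<open>r - 1\<close> and a factor on the other side at least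
      \<open>1 - 1 / r\<close>; passing from the outer to the inner circle swaps the sides.\<close>
    have key: "q (N - Suc i) ^ m * (1 - t ^ Suc (N - Suc i)) ^ (2 * m)
        \<le> (\<Prod>x\<in>Yp i. norm (p x w)) * (\<Prod>x\<in>Yn i. norm (p x w))" if "i < N" for i
    proof -
      define r where "r = q (N - Suc i)"
      have r: "r = exp (2 * \<gamma> * ((N - i) * L))"
        using that by (simp add: r_def q_def Qpow Suc_diff_Suc del: power_Suc)
      have r': "r = exp (2 * \<gamma> * (real N - real i) * L)" "1 / r = exp (2 * \<gamma> * (real i - real N) * L)"
        using that unfolding r by (simp_all add: of_nat_diff exp_minus[symmetric] inverse_eq_divide[symmetric] algebra_simps)
      have r1: "r \<ge> 1" "1 / r \<le> 1" using q[of "N - Suc i"] by (auto simp: r_def)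
      have big: "r - 1 \<le> norm (1 - z)" if "norm z = exp (2 * \<gamma> * y)" "(real N - real i) * L \<le> y" for z :: complex and y
        using norm_one_minus_ge(1)[of z] mono[OF that(2)] that(1) r'(1) unfolding mult.assoc by linarith
      have small: "1 - 1 / r \<le> norm (1 - z)" if "norm z = exp (2 * \<gamma> * y)" "y \<le> (real i - real N) * L" for z :: complex and y
        using norm_one_minus_ge(2)[of z] mono[OF that(2)] that(1) r'(2) unfolding mult.assoc by linarith
      have np: "norm (w / of_real (exp (2 * \<gamma> * x))) = exp (2 * \<gamma> * (y - x))"
               "norm (of_real (exp (2 * \<gamma> * x)) / w) = exp (2 * \<gamma> * (x - y))"
        if "norm w = exp (2 * \<gamma> * y)" for x y
        using that by (simp_all add: norm_divide exp_diff right_diff_distrib)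
      have iL: "real i * L \<ge> 0" using L by simp
      have pw: "r ^ m * (1 - 1 / r) ^ (2 * m) = (r - 1) ^ m * (1 - 1 / r) ^ m"
      proof -
        have "r ^ m * (1 - 1 / r) ^ (2 * m) = (r * (1 - 1 / r)) ^ m * (1 - 1 / r) ^ m"
          by (simp add: mult_2 power_add power_mult_distrib)
        also have "r * (1 - 1 / r) = r - 1" using r1 by (simp add: right_diff_distrib)
        finally show ?thesis .
      qed
      from w have "(r - 1) ^ m * (1 - 1 / r) ^ m
          \<le> (\<Prod>x\<in>Yp i. norm (p x w)) * (\<Prod>x\<in>Yn i. norm (p x w))"
      proof
        assume w: "norm w = exp (2 * \<gamma> * R N)"
        have "r - 1 \<le> norm (p x w)" if "x \<in> Yp i" for x
        proof -
          have "(real N - real i) * L \<le> R N - x"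
            using Yp[OF that] L iL by (simp add: R_def algebra_simps)
          from big[OF np(1)[OF w] this] show ?thesis
            using Yp(3)[OF that] by (simp add: p_def)
        qed
        moreover have "1 - 1 / r \<le> norm (p x w)" if "x \<in> Yn i" for x
        proof -
          have "x - R N \<le> (real i - real N) * L"
            using Yn[OF that] L iL by (simp add: R_def algebra_simps)
          from small[OF np(2)[OF w] this] show ?thesis
            using Yn(3)[OF that] by (simp add: p_def)
        qed
        ultimately show ?thesis
          using power_card_le_prod[of "Yp i" "r - 1" "\<lambda>x. norm (p x w)"]
            power_card_le_prod[of "Yn i" "1 - 1 / r" "\<lambda>x. norm (p x w)"] r1 Y
          by (intro mult_mono prod_nonneg) auto
      next
        assume w: "norm w = exp (2 * \<gamma> * (- R N))"
        have "r - 1 \<le> norm (p x w)" if "x \<in> Yn i" for x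
        proof -
          have "(real N - real i) * L \<le> x - - R N"
            using Yn[OF that] L iL by (simp add: R_def algebra_simps)
          from big[OF np(2)[OF w] this] show ?thesis
            using Yn(3)[OF that] by (simp add: p_def)
        qed
        moreover have "1 - 1 / r \<le> norm (p x w)" if "x \<in> Yp i" for x
        proof -
          have "- R N - x \<le> (real i - real N) * L"
            using Yp[OF that] L iL by (simp add: R_def algebra_simps)
          from small[OF np(1)[OF w] this] show ?thesis
            using Yp(3)[OF that] by (simp add: p_def)
        qed
        ultimately show ?thesis
          using power_card_le_prod[of "Yn i" "r - 1" "\<lambda>x. norm (p x w)"]
            power_card_le_prod[of "Yp i" "1 - 1 / r" "\<lambda>x. norm (p x w)"] r1 Y
          unfolding mult.commute[of "\<Prod>x\<in>Yp i. norm (p x w)"]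
          by (intro mult_mono prod_nonneg) auto
      qed
      then show ?thesis
        unfolding pw[symmetric] unfolding r_def tq .
    qed
    \<comment> \<open>The exponents \<open>2 * \<gamma> * L * (i + 1)\<close> add up to a triangular
      number; this is the quadratic growth that beats \<open>F\<close>.\<close>
    have "(\<Prod>i<N. q i) = exp (\<gamma> * L * N * (real N + 1))"
    proof (induction N)
      case (Suc N)
      then show ?case
        by (simp add: q_def Qpow exp_add[symmetric] algebra_simps del: power_Suc)
    qed simp
    then have "exp (\<gamma> * L * m * N * (real N + 1)) = (\<Prod>i<N. q i) ^ m"
      by (simp add: exp_of_nat_mult[symmetric] mult_ac)
    moreover have "\<kappa> ^ (2 * m) \<le> (\<Prod>i<N. 1 - t ^ Suc i) ^ (2 * m)"
      using t \<kappa> unfolding \<kappa>_def by (intro power_mono prod_one_minus_geometric_ge) auto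
    moreover have "0 \<le> prod q {..<N}"
      using q by (intro prod_nonneg) (auto intro: order_trans[of 0 1])
    ultimately have "exp (\<gamma> * L * m * N * (real N + 1)) * \<kappa> ^ (2 * m)
        \<le> (\<Prod>i<N. q i) ^ m * (\<Prod>i<N. 1 - t ^ Suc i) ^ (2 * m)"
      by (simp add: mult_left_mono)
    also have "\<dots> = (\<Prod>i<N. q i ^ m * (1 - t ^ Suc i) ^ (2 * m))"
      by (simp add: prod_power_distrib prod.distrib)
    also have "\<dots> = (\<Prod>i<N. q (N - Suc i) ^ m * (1 - t ^ Suc (N - Suc i)) ^ (2 * m))"
      by (rule prod.nat_diff_reindex[symmetric])
    also have "\<dots> \<le> (\<Prod>i<N. (\<Prod>x\<in>Yp i. norm (p x w)) * (\<Prod>x\<in>Yn i. norm (p x w)))"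
      using t q by (intro prod_mono conjI key)
        (auto intro!: mult_nonneg_nonneg zero_le_power power_le_one intro: order_trans[of 0 1]
              simp: simp del: power_Suc)
    also have "\<dots> = norm (\<Prod>x\<in>(\<Union>i<N. Y i). p x w)"
      unfolding prod_norm[symmetric] by (rule prod_Y[symmetric])
    finally show ?thesis .
  qed

  have bound: "norm (F w0) \<le> E ^ (2 * m) * (C * exp (\<gamma> * (R N)\<^sup>2) / (exp (\<gamma> * L * m * N * (real N + 1)) * \<kappa> ^ (2 * m)))"
    if N: "exp (2 * \<gamma> * (- R N)) < norm w0" "norm w0 < exp (2 * \<gamma> * R N)" for N
  proof -
    define D where "D = exp (\<gamma> * L * m * N * (real N + 1)) * \<kappa> ^ (2 * m)"
    have D: "D > 0" using \<kappa> by (simp add: D_def)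
    have inj: "inj_on (\<lambda>x. complex_of_real (exp (2 * \<gamma> * x))) (\<Union>i<N. Y i)"
      using \<gamma> by (auto simp: inj_on_def)
    have "\<exists>H. H holomorphic_on - {0} \<and> (\<forall>w\<in>-{0}. F w =
        H w * (\<Prod>x\<in>(\<Union>i<N. Y i). (w - of_real (exp (2 * \<gamma> * x))) * u x w))"
    proof (rule holomorphic_factor_simple_zeros[OF finY _ hol inj])
      show "u x holomorphic_on - {0}" for x
        unfolding u_def by (cases "0 \<le> x") (auto intro!: holomorphic_intros)
    qed (use Z(4) in \<open>auto simp: u_def Y_def Yp_def Yn_def\<close>)
    then obtain H where H: "H holomorphic_on - {0}"
      and FH: "\<forall>w\<in>-{0}. F w = H w * (\<Prod>x\<in>(\<Union>i<N. Y i). (w - of_real (exp (2 * \<gamma> * x))) * u x w)"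
      by blast
    have FH: "F w = H w * (\<Prod>x\<in>(\<Union>i<N. Y i). p x w)" if "w \<noteq> 0" for w
      using FH that p_u[OF that] by simp
    define A where "A = {w :: complex. exp (2 * \<gamma> * (- R N)) < norm w \<and> norm w < exp (2 * \<gamma> * R N)}"
    have clA: "closure A \<subseteq> {w. exp (2 * \<gamma> * (- R N)) \<le> norm w \<and> norm w \<le> exp (2 * \<gamma> * R N)}"
      by (rule closure_minimal) (auto simp: A_def intro!: closed_Collect_conj closed_Collect_le continuous_intros)
    have opA: "open A"
      unfolding A_def by (intro open_Collect_conj open_Collect_less continuous_intros)
    have cl0: "closure A \<subseteq> - {0}"
      using clA by (auto simp: not_le)
    \<comment> \<open>The quotient \<open>H\<close> is bounded on both circles by the growth of
      \<open>F\<close> over the lower bound for the product; the maximum modulus principle carries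
      this bound to \<open>w0\<close>.\<close>
    have "norm (H w0) \<le> C * exp (\<gamma> * (R N)\<^sup>2) / D"
    proof (rule maximum_modulus_frontier[of H A])
      show "H holomorphic_on interior A"
        using opA closure_subset[of A] cl0 by (intro holomorphic_on_subset[OF H]) (auto simp: interior_open)
      show "continuous_on (closure A) H"
        using cl0 holomorphic_on_imp_continuous_on[OF H] continuous_on_subset by blast
      show "bounded A"
        by (rule boundedI[of _ "exp (2 * \<gamma> * R N)"]) (auto simp: A_def)
      show "w0 \<in> A" using N by (simp add: A_def)
      fix w assume "w \<in> frontier A"
      then have *: "w \<in> closure A" "w \<notin> A" using opA by (auto simp: frontier_def interior_open)
      then have w: "norm w = exp (2 * \<gamma> * R N) \<or> norm w = exp (2 * \<gamma> * (- R N))"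
        using clA by (auto simp: A_def)
      have "w \<noteq> 0" using * cl0 by auto
      have "norm (F w) \<le> C * exp (\<gamma> * (R N)\<^sup>2)"
        using w growth[of w "R N"] growth[of w "- R N"] by auto
      then have le: "norm (H w) * norm (\<Prod>x\<in>(\<Union>i<N. Y i). p x w) \<le> C * exp (\<gamma> * (R N)\<^sup>2)"
        using FH[OF \<open>w \<noteq> 0\<close>] by (simp add: norm_mult)
      have "norm (H w) * D \<le> norm (H w) * norm (\<Prod>x\<in>(\<Union>i<N. Y i). p x w)"
        using lower[OF w] unfolding D_def by (intro mult_left_mono) auto
      with le show "norm (H w) \<le> C * exp (\<gamma> * (R N)\<^sup>2) / D"
        using D by (simp add: field_simps)
    qed
    then have "norm (H w0) * norm (\<Prod>x\<in>(\<Union>i<N. Y i). p x w0) \<le> C * exp (\<gamma> * (R N)\<^sup>2) / D * E ^ (2 * m)"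
      by (intro mult_mono upper) (auto intro: order_trans[OF norm_ge_zero])
    then show ?thesis
      unfolding D_def[symmetric] using FH[OF \<open>w0 \<noteq> 0\<close>] by (simp add: norm_mult mult.commute)
  qed
  \<comment> \<open>The excess of zeros per window. It enters through \<open>(R N)\<^sup>2 - L * m *
    N * (N + 1) = L * (N + 1) * (L - d * N)\<close>, which tends to minus infinity.\<close>
  define d where "d = m - L"
  have d: "d > 0" using L by (simp add: d_def)
  have "(\<lambda>N::nat. E ^ (2 * m) * C / \<kappa> ^ (2 * m) * exp (\<gamma> * L * ((real N + 1) * (L - d * N)))) \<longlonglongrightarrow> E ^ (2 * m) * C / \<kappa> ^ (2 * m) * 0"
  proof (rule tendsto_mult_left)
    show "(\<lambda>N::nat. exp (\<gamma> * L * ((real N + 1) * (L - d * N)))) \<longlonglongrightarrow> 0"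
      using \<gamma> L d by real_asymp
  qed
  moreover have "(\<lambda>N::nat. E ^ (2 * m) * C / \<kappa> ^ (2 * m) * exp (\<gamma> * L * ((real N + 1) * (L - d * N))))
     = (\<lambda>N. E ^ (2 * m) * (C * exp (\<gamma> * (R N)\<^sup>2) / (exp (\<gamma> * L * m * N * (real N + 1)) * \<kappa> ^ (2 * m))))"
  proof
    fix N :: nat
    have "exp (\<gamma> * L * ((real N + 1) * (L - d * N))) = exp (\<gamma> * (R N)\<^sup>2) / exp (\<gamma> * L * m * N * (real N + 1))"
      unfolding exp_diff[symmetric] by (simp add: R_def d_def power2_eq_square algebra_simps)
    then show "E ^ (2 * m) * C / \<kappa> ^ (2 * m) * exp (\<gamma> * L * ((real N + 1) * (L - d * N)))
     = E ^ (2 * m) * (C * exp (\<gamma> * (R N)\<^sup>2) / (exp (\<gamma> * L * m * N * (real N + 1)) * \<kappa> ^ (2 * m)))"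
      by (simp add: mult_ac)
  qed
  moreover have "eventually (\<lambda>N. exp (2 * \<gamma> * (- R N)) < norm w0 \<and> norm w0 < exp (2 * \<gamma> * R N)) sequentially"
  proof (intro eventually_conj)
    have "(\<lambda>N. exp (2 * \<gamma> * (- R N))) \<longlonglongrightarrow> 0"
      unfolding R_def using \<gamma> L by real_asymp
    then show "eventually (\<lambda>N. exp (2 * \<gamma> * (- R N)) < norm w0) sequentially"
      using \<open>w0 \<noteq> 0\<close> by (intro order_tendstoD) auto
    have "filterlim (\<lambda>N. exp (2 * \<gamma> * R N)) at_top sequentially"
      unfolding R_def using \<gamma> L by real_asymp
    then show "eventually (\<lambda>N. norm w0 < exp (2 * \<gamma> * R N)) sequentially"
      by (simp add: filterlim_at_top_dense)
  qed
  ultimately have "norm (F w0) \<le> 0"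
    using bound by (intro tendsto_lowerbound[of _ 0 sequentially "norm (F w0)"]) (auto elim: eventually_mono)
  then show ?thesis by simp
qed

section \<open>Averaging over an exponential distribution\<close>

abbreviation std_exponential :: "real measure" where
  "std_exponential \<equiv> density lborel (exponential_density 1)"

lemma prob_space_std_exponential: "prob_space std_exponential"
  by (rule prob_space_exponential_density) simp

lemma sigma_finite_std_exponential: "sigma_finite_measure std_exponential"
  using prob_space_std_exponential
  by (simp add: prob_space_imp_sigma_finite)

lemma integral_std_exponential:
  fixes f :: "real \<Rightarrow> 'b :: {banach, second_countable_topology}"
  assumes "f \<in> borel_measurable borel"
  shows "(LINT u|std_exponential. f u) = (LINT u|lborel. exponential_density 1 u *\<^sub>R f u)"
  using assms by (intro integral_density) (auto intro!: exponential_density_nonneg)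

text \<open>For \<open>\<delta> \<noteq> 0\<close> this is convolution with an exponential density
  of scale \<open>\<bar>\<delta>\<bar>\<close>, supported on the half-line of the sign of
  \<open>\<delta>\<close>. Written as an expectation, it needs no case distinction on the sign, and
  \<open>\<delta> = 0\<close> gives the identity.\<close>

definition exp_smooth :: "real \<Rightarrow> (real \<Rightarrow> real) \<Rightarrow> real \<Rightarrow> real" where
  "exp_smooth \<delta> h x = (LINT u|std_exponential. h (x - \<delta> * u))"

lemma exp_smooth_zero [simp]: "exp_smooth 0 h = h"
  using prob_space.prob_space[OF prob_space_std_exponential] by (auto simp: exp_smooth_def)

lemma integrable_std_exponential_bounded:
  fixes f :: "real \<Rightarrow> 'b :: {banach, second_countable_topology}"
  assumes [measurable]: "f \<in> borel_measurable borel" and "\<And>x. norm (f x) \<le> B"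
  shows "integrable std_exponential f"
proof -
  interpret prob_space std_exponential by (rule prob_space_std_exponential)
  show ?thesis
    by (rule integrable_const_bound[of _ B]) (use assms in auto)
qed

lemma exp_smooth_measurable [measurable]:
  assumes [measurable]: "h \<in> borel_measurable borel"
  shows "exp_smooth \<delta> h \<in> borel_measurable borel"
proof -
  interpret sigma_finite_measure std_exponential by (rule sigma_finite_std_exponential)
  show ?thesis
    unfolding exp_smooth_def by measurable
qed

lemma abs_exp_smooth_le:
  assumes [measurable]: "h \<in> borel_measurable borel" and "\<And>x. \<bar>h x\<bar> \<le> B"
  shows "\<bar>exp_smooth \<delta> h x\<bar> \<le> B"
proof -
  interpret prob_space std_exponential by (rule prob_space_std_exponential)
  have int: "integrable std_exponential (\<lambda>u. h (x - \<delta> * u))"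
    by (rule integrable_std_exponential_bounded[of _ B]) (use assms in auto)
  have "exp_smooth \<delta> h x \<le> B"
    unfolding exp_smooth_def by (rule integral_le_const[OF int]) (use assms(2) in \<open>auto simp: abs_le_iff\<close>)
  moreover have "- B \<le> exp_smooth \<delta> h x"
    unfolding exp_smooth_def by (rule integral_ge_const[OF int]) (use assms(2) in \<open>auto simp: abs_le_iff minus_le_iff\<close>)
  ultimately show ?thesis by simp
qed

text \<open>Reduces both signs of \<open>\<delta>\<close> to the case 1.\<close>

lemma exp_smooth_rescale: "exp_smooth \<delta> h x = exp_smooth 1 (\<lambda>y. h (\<delta> * y)) (x / \<delta>)" if "\<delta> \<noteq> 0"
  using that by (simp add: exp_smooth_def right_diff_distrib)

text \<open>Substituting \<open>v = x - u\<close> turns \<open>exp x\<close> times the average into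
  the integral of \<open>exp v * h v\<close> over \<open>v \<le> x\<close>, to which the fundamental
  theorem of calculus applies.\<close>

lemma exp_smooth_one_has_derivative:
  assumes cont: "continuous_on UNIV h" and bnd: "\<And>x. \<bar>h x\<bar> \<le> B"
  shows "((\<lambda>y. exp y * exp_smooth 1 h y) has_real_derivative exp y * h y) (at y)"
proof -
  have [measurable]: "h \<in> borel_measurable borel"
    using cont by (rule borel_measurable_continuous_onI)
  define k where "k = (\<lambda>v. exp v * h v)"
  have [measurable]: "k \<in> borel_measurable borel" unfolding k_def by measurable
  \<comment> \<open>The argument is written \<open>x + - 1 * v\<close> to fit the affine change of
    variables used below.\<close>
  have eq: "exp x * (exponential_density 1 (x + - 1 * v) * h v) = indicator {..x} v *\<^sub>R k v" for x v
    by (auto simp: exponential_density_def k_def indicator_def exp_diff exp_minus field_simps)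
  have int: "set_integrable lborel {..x} k"
   and val: "exp x * exp_smooth 1 h x = (LINT v:{..x}|lborel. k v)" for x
  proof -
    have "integrable std_exponential (\<lambda>u. h (x - u))"
      by (rule integrable_std_exponential_bounded[of _ B]) (use bnd in auto)
    then have "integrable lborel (\<lambda>u. exponential_density 1 u *\<^sub>R h (x - u))"
      by (subst (asm) integrable_density) (auto intro!: exponential_density_nonneg)
    then have "integrable lborel (\<lambda>v. exponential_density 1 (x + - 1 * v) *\<^sub>R h (x - (x + - 1 * v)))"
      by (rule lborel_integrable_real_affine) simp
    then have "integrable lborel (\<lambda>v. exp x * (exponential_density 1 (x + - 1 * v) * h v))"
      by simp
    then show "set_integrable lborel {..x} k"
      unfolding set_integrable_def eq .
    have "exp_smooth 1 h x = (LINT u|lborel. exponential_density 1 u *\<^sub>R h (x - u))"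
      unfolding exp_smooth_def by (subst integral_std_exponential) auto
    also have "\<dots> = (LINT v|lborel. exponential_density 1 (x + - 1 * v) * h v)"
      by (subst lborel_integral_real_affine[of "- 1" _ x]) auto
    finally show "exp x * exp_smooth 1 h x = (LINT v:{..x}|lborel. k v)"
      unfolding set_lebesgue_integral_def eq[symmetric] by simp
  qed
  \<comment> \<open>The integral over the half-line is cut at \<open>a\<close>: the part below
    \<open>a\<close> is constant near \<open>y\<close>, and only an integral over a compact interval
    has to be differentiated.\<close>
  define a b where "a = y - 1" and "b = y + 1"
  have split: "exp x * exp_smooth 1 h x = (LINT v:{..<a}|lborel. k v) + integral {a..x} k" if "a \<le> x" for x
  proof -
    have i1: "set_integrable lborel {..<a} k" and i2: "set_integrable lborel {a..x} k"
      using that by (auto intro!: set_integrable_subset[OF int[of x]])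
    have "{..x} = {..<a} \<union> {a..x}" using that by auto
    then have "exp x * exp_smooth 1 h x = (LINT v:{..<a}|lborel. k v) + (LINT v:{a..x}|lborel. k v)"
      unfolding val by (simp only:, intro set_integral_Un i1 i2) auto
    with set_borel_integral_eq_integral(2)[OF i2] show ?thesis by simp
  qed
  have "((\<lambda>x. (LINT v:{..<a}|lborel. k v) + integral {a..x} k) has_real_derivative k y) (at y within {a..b})"
  proof -
    have "continuous_on {a..b} k"
      unfolding k_def by (intro continuous_intros continuous_on_subset[OF cont]) auto
    then have "((\<lambda>x. integral {a..x} k) has_real_derivative k y) (at y within {a..b})"
      by (rule integral_has_real_derivative) (auto simp: a_def b_def)
    from DERIV_add[OF DERIV_const this] show ?thesis by simp
  qed
  then have "((\<lambda>x. exp x * exp_smooth 1 h x) has_real_derivative k y) (at y within {a..b})"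
    by (rule has_field_derivative_transform_within[OF _ zero_less_one])
      (simp_all add: split a_def b_def)
  moreover have "at y within {a..b} = at y"
    by (rule at_within_interior) (auto simp: a_def b_def)
  ultimately show ?thesis by (simp add: k_def)
qed

text \<open>The weight \<open>exp (x / \<delta>)\<close> has no zeros, so Rolle's theorem for the
  weighted average relates the zeros of the average to those of \<open>h\<close>.\<close>

lemma exp_smooth_has_derivative:
  assumes "\<delta> \<noteq> 0" and cont: "continuous_on UNIV h" and bnd: "\<And>x. \<bar>h x\<bar> \<le> B"
  shows "((\<lambda>x. exp (x / \<delta>) * exp_smooth \<delta> h x) has_real_derivative exp (x / \<delta>) * h x / \<delta>) (at x)"
proof -
  have "((\<lambda>y. exp y * exp_smooth 1 (\<lambda>y. h (\<delta> * y)) y) has_real_derivative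
      exp (x / \<delta>) * h (\<delta> * (x / \<delta>))) (at (x / \<delta>))"
    by (rule exp_smooth_one_has_derivative[of _ B])
      (use bnd in \<open>auto intro!: continuous_intros continuous_on_compose2[OF cont]\<close>)
  moreover have "((\<lambda>x. x / \<delta>) has_real_derivative 1 / \<delta>) (at x)"
    using assms(1) by (auto intro!: derivative_eq_intros)
  ultimately have "((\<lambda>x. exp (x / \<delta>) * exp_smooth 1 (\<lambda>y. h (\<delta> * y)) (x / \<delta>)) has_real_derivative
      exp (x / \<delta>) * h (\<delta> * (x / \<delta>)) * (1 / \<delta>)) (at x)"
    by (rule DERIV_chain2[where g = "\<lambda>x. x / \<delta>"])
  then show ?thesis
    using assms(1) by (simp add: exp_smooth_rescale[symmetric])
qed

lemma continuous_exp_smooth: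
  assumes cont: "continuous_on UNIV h" and bnd: "\<And>x. \<bar>h x\<bar> \<le> B"
  shows "continuous_on UNIV (exp_smooth \<delta> h)"
proof (cases "\<delta> = 0")
  case False
  have "isCont (\<lambda>x. exp (- x / \<delta>) * (exp (x / \<delta>) * exp_smooth \<delta> h x)) x" for x
    by (intro continuous_intros DERIV_isCont[OF exp_smooth_has_derivative[OF False cont bnd]])
       (use False in auto)
  then show ?thesis
    by (auto simp: continuous_on_eq_continuous_at exp_minus field_simps)
qed (use cont in simp)

section \<open>Counting zeros with Rolle's theorem\<close>

text \<open>Induction adding a new largest point \<open>b\<close>: Rolle's theorem gives a critical
  point beyond the old maximum. The half-open interval keeps it apart from the earlier ones, and is
  empty for a single zero, where no critical point is claimed.\<close>

lemma Rolle_card: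
  fixes f f' :: "real \<Rightarrow> real"
  assumes der: "\<And>x. (f has_real_derivative f' x) (at x)"
    and "finite A" "A \<noteq> {}" "\<And>z. z \<in> A \<Longrightarrow> f z = 0"
  shows "\<exists>Y. finite Y \<and> Suc (card Y) = card A \<and> Y \<subseteq> {Min A..<Max A} \<and> (\<forall>y\<in>Y. f' y = 0)"
  using assms(2-)
proof (induction A rule: finite_linorder_max_induct)
  case (insert b A)
  show ?case
  proof (cases "A = {}")
    case False
    then obtain Y where Y: "finite Y" "Suc (card Y) = card A" "Y \<subseteq> {Min A..<Max A}" "\<forall>y\<in>Y. f' y = 0"
      using insert by auto
    have lt: "Max A < b" "Max A \<in> A" "Min A \<in> A" "Min A \<le> Max A"
      using insert.hyps False by auto
    obtain y where y: "Max A < y" "y < b" "f' y = 0"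
    proof -
      have "\<exists>z. Max A < z \<and> z < b \<and> DERIV f z :> 0"
      proof (rule Rolle)
        show "f (Max A) = f b" using insert.prems lt by simp
        show "continuous_on {Max A..b} f"
          by (auto intro!: continuous_at_imp_continuous_on DERIV_isCont[OF der])
        show "f differentiable (at x)" for x
          using der real_differentiable_def by blast
      qed (rule lt)
      then show ?thesis using that DERIV_unique[OF der] by blast
    qed
    have "Min (insert b A) = Min A" "Max (insert b A) = b"
      using insert.hyps False lt by (auto simp: Min_insert Max_insert)
    moreover have "y \<notin> Y" "b \<notin> A" using Y(3) y lt insert.hyps by auto
    moreover have "insert y Y \<subseteq> {Min A..<b}" using Y(3) y lt by auto
    ultimately show ?thesis
      using Y insert.hyps y by (intro exI[of _ "insert y Y"]) auto
  qed (auto intro!: exI[of _ "{}"])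
qed simp

text \<open>A quantitative stand-in for lower density, uniform in the centre of the window. Asking
  for a finite set of exactly \<open>M\<close> zeros also covers windows with infinitely many zeros,
  where \<open>card\<close> would give 0.\<close>

definition zeros_in_windows :: "nat \<Rightarrow> real \<Rightarrow> (real \<Rightarrow> real) \<Rightarrow> bool" where
  "zeros_in_windows M R f \<longleftrightarrow>
     (\<forall>x. \<exists>Z\<subseteq>{x - R..x + R}. finite Z \<and> card Z = M \<and> (\<forall>z\<in>Z. f z = 0))"

lemma zeros_in_windows_antimono:
  assumes "zeros_in_windows M R f" "M' \<le> M"
  shows "zeros_in_windows M' R f"
  unfolding zeros_in_windows_def
proof
  fix x
  obtain Z where Z: "Z\<subseteq>{x - R..x + R}" "finite Z" "card Z = M" "\<forall>z\<in>Z. f z = 0"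
    using assms(1) unfolding zeros_in_windows_def by blast
  then obtain Z' where "Z' \<subseteq> Z" "card Z' = M'"
    using assms(2) obtain_subset_with_card_n by metis
  with Z show "\<exists>Z\<subseteq>{x - R..x + R}. finite Z \<and> card Z = M' \<and> (\<forall>z\<in>Z. f z = 0)"
    by (intro exI[of _ Z']) (auto intro: finite_subset)
qed

text \<open>Rolle's theorem is applied to the weighted average within each window; the critical
  points stay between the smallest and the largest zero, hence in the same window. For
  \<open>\<delta> = 0\<close> one zero is simply discarded.\<close>

lemma zeros_in_windows_exp_smooth:
  assumes "zeros_in_windows (Suc M) R (exp_smooth \<delta> h)"
    and cont: "continuous_on UNIV h" and bnd: "\<And>x. \<bar>h x\<bar> \<le> B"
  shows "zeros_in_windows M R h"
proof (cases "\<delta> = 0")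
  case True
  with assms(1) show ?thesis by (auto intro: zeros_in_windows_antimono)
next
  case False
  show ?thesis
    unfolding zeros_in_windows_def
  proof
    fix x
    obtain Z where Z: "Z\<subseteq>{x - R..x + R}" "finite Z" "card Z = Suc M" "\<forall>z\<in>Z. exp_smooth \<delta> h z = 0"
      using assms(1) unfolding zeros_in_windows_def by blast
    have "Z \<noteq> {}" using Z by auto
    then obtain Y where Y: "finite Y" "Suc (card Y) = card Z" "Y \<subseteq> {Min Z..<Max Z}"
      "\<forall>y\<in>Y. exp (y / \<delta>) * h y / \<delta> = 0"
      using Rolle_card[OF exp_smooth_has_derivative[OF False cont bnd], of Z] Z by auto
    have "Min Z \<in> Z" "Max Z \<in> Z" using \<open>Z \<noteq> {}\<close> Z by auto
    with Y Z have "Y \<subseteq> {x - R..x + R}" by fastforce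
    with Y Z False show "\<exists>Z\<subseteq>{x - R..x + R}. finite Z \<and> card Z = M \<and> (\<forall>z\<in>Z. h z = 0)"
      by (intro exI[of _ Y]) auto
  qed
qed

section \<open>Series of shifts\<close>

lemma suminf_eq_infsum_nat:
  fixes f :: "nat \<Rightarrow> 'a :: {topological_comm_monoid_add, t2_space}"
  assumes "f summable_on UNIV"
  shows "infsum f UNIV = suminf f"
  using has_sum_imp_sums[OF has_sum_infsum[OF assms]] by (rule sums_unique)

text \<open>A bound on the periodization of \<open>h\<close>, stated through finite sums so that no
  convergence is presupposed. It gives absolute convergence of series with bounded coefficients, and
  averaging preserves it with the same \<open>B\<close>.\<close>

definition shift_bounded :: "real \<Rightarrow> (real \<Rightarrow> real) \<Rightarrow> bool" where
  "shift_bounded B h \<longleftrightarrow> h \<in> borel_measurable borel \<and> (\<forall>x. 0 \<le> h x) \<and>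
     (\<forall>F x. finite F \<longrightarrow> (\<Sum>k\<in>F. h (x - of_int k)) \<le> B)"

definition real_shift_series :: "(real \<Rightarrow> real) \<Rightarrow> (int \<Rightarrow> real) \<Rightarrow> real \<Rightarrow> real" where
  "real_shift_series h a x = (\<Sum>\<^sub>\<infinity>k. a k * h (x - of_int k))"

lemma shift_boundedD:
  assumes "shift_bounded B h"
  shows "h \<in> borel_measurable borel" "0 \<le> h x" "\<bar>h x\<bar> \<le> B" "0 \<le> B"
    "finite F \<Longrightarrow> (\<Sum>k\<in>F. h (x - of_int k)) \<le> B"
proof -
  show 1: "h \<in> borel_measurable borel" "0 \<le> h x" "finite F \<Longrightarrow> (\<Sum>k\<in>F. h (x - of_int k)) \<le> B"
    using assms by (auto simp: shift_bounded_def)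
  have "(\<Sum>k\<in>{0}. h (x - of_int k)) \<le> B"
    using assms unfolding shift_bounded_def by blast
  with 1 show "\<bar>h x\<bar> \<le> B" "0 \<le> B" by auto
qed

lemma shift_bounded_partial_sums:
  assumes "shift_bounded B h" "\<forall>k. \<bar>a k\<bar> \<le> A" "finite F"
  shows "(\<Sum>k\<in>F. norm (a k * h (x - of_int k))) \<le> A * B"
proof -
  have "(\<Sum>k\<in>F. norm (a k * h (x - of_int k))) \<le> (\<Sum>k\<in>F. A * h (x - of_int k))"
    using shift_boundedD(2)[OF assms(1)] assms(2)
    by (intro sum_mono) (auto simp: abs_mult intro!: mult_right_mono)
  also have "\<dots> = A * (\<Sum>k\<in>F. h (x - of_int k))" by (simp add: sum_distrib_left)
  also have "\<dots> \<le> A * B"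
    using shift_boundedD(5)[OF assms(1,3)] spec[OF assms(2), of 0] by (intro mult_left_mono) auto
  finally show ?thesis .
qed

lemma shift_series_abs_summable:
  assumes "shift_bounded B h" "\<forall>k. \<bar>a k\<bar> \<le> A"
  shows "(\<lambda>k. norm (a k * h (x - of_int k))) summable_on UNIV"
  unfolding abs_summable_iff_bdd_above
  using shift_bounded_partial_sums[OF assms] by (intro bdd_aboveI[of _ "A * B"]) auto

lemma abs_real_shift_series_le:
  assumes "shift_bounded B h" "\<forall>k. \<bar>a k\<bar> \<le> A"
  shows "\<bar>real_shift_series h a x\<bar> \<le> A * B"
proof -
  note s = shift_series_abs_summable[OF assms, of x]
  have "norm (\<Sum>\<^sub>\<infinity>k. a k * h (x - of_int k)) \<le> (\<Sum>\<^sub>\<infinity>k. norm (a k * h (x - of_int k)))"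
    by (rule norm_infsum_bound[OF s])
  also have "\<dots> \<le> A * B"
    by (rule infsum_le_finite_sums[OF s shift_bounded_partial_sums[OF assms]])
  finally show ?thesis by (simp add: real_shift_series_def)
qed

text \<open>Enumerating the integers gives a series over the naturals, the form in which sums and
  integrals are interchanged.\<close>

lemma real_shift_series_eq_suminf:
  assumes "shift_bounded B h" "\<forall>k. \<bar>a k\<bar> \<le> A"
  shows "summable (\<lambda>n. norm (a (int_decode n) * h (x - of_int (int_decode n))))"
    and "real_shift_series h a x = (\<Sum>n. a (int_decode n) * h (x - of_int (int_decode n)))"
proof -
  note s = shift_series_abs_summable[OF assms, of x]
  show 1: "summable (\<lambda>n. norm (a (int_decode n) * h (x - of_int (int_decode n))))"
    using s summable_on_reindex_bij_betw[OF bij_int_decode, of "\<lambda>k. norm (a k * h (x - of_int k))"]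
    by (intro summable_on_imp_summable) simp
  have "real_shift_series h a x = (\<Sum>\<^sub>\<infinity>n. a (int_decode n) * h (x - of_int (int_decode n)))"
    unfolding real_shift_series_def
    by (rule infsum_reindex_bij_betw[OF bij_int_decode, symmetric])
  also have "\<dots> = (\<Sum>n. a (int_decode n) * h (x - of_int (int_decode n)))"
    by (rule suminf_eq_infsum_nat[OF norm_summable_imp_summable_on[OF 1]])
  finally show "real_shift_series h a x = (\<Sum>n. a (int_decode n) * h (x - of_int (int_decode n)))" .
qed

text \<open>Averaging commutes with finite sums of shifts, and an average of values of modulus at
  most \<open>B\<close> is again at most \<open>B\<close>.\<close>

lemma shift_bounded_exp_smooth:
  assumes "shift_bounded B h"
  shows "shift_bounded B (exp_smooth \<delta> h)"
  unfolding shift_bounded_def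
proof (intro conjI allI impI)
  note [measurable] = shift_boundedD(1)[OF assms]
  show "exp_smooth \<delta> h \<in> borel_measurable borel" by simp
  show "0 \<le> exp_smooth \<delta> h x" for x
    unfolding exp_smooth_def using shift_boundedD(2)[OF assms] by (intro integral_nonneg_AE) auto
  fix F :: "int set" and x assume F: "finite F"
  have "(\<Sum>k\<in>F. exp_smooth \<delta> h (x - of_int k)) = exp_smooth \<delta> (\<lambda>y. \<Sum>k\<in>F. h (y - of_int k)) x"
    unfolding exp_smooth_def
  proof (subst Bochner_Integration.integral_sum[symmetric])
    show "integrable std_exponential (\<lambda>u. h (x - of_int k - \<delta> * u))" for k
      by (rule integrable_std_exponential_bounded[of _ B]) (use shift_boundedD(3)[OF assms] in auto)
  qed (simp add: algebra_simps)
  also have "\<dots> \<le> B"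
  proof (rule abs_le_D1[OF abs_exp_smooth_le])
    fix y
    have "0 \<le> (\<Sum>k\<in>F. h (y - of_int k))"
      by (intro sum_nonneg shift_boundedD(2)[OF assms])
    then show "\<bar>\<Sum>k\<in>F. h (y - of_int k)\<bar> \<le> B"
      using shift_boundedD(5)[OF assms F, of y] by simp
  qed simp
  finally show "(\<Sum>k\<in>F. exp_smooth \<delta> h (x - of_int k)) \<le> B" .
qed

text \<open>Averaging commutes with translation, so the claim is an interchange of the series with
  the integral over \<open>u\<close>.\<close>

lemma real_shift_series_exp_smooth:
  assumes h: "shift_bounded B h" and a: "\<forall>k. \<bar>a k\<bar> \<le> A"
  shows "real_shift_series (exp_smooth \<delta> h) a = exp_smooth \<delta> (real_shift_series h a)"
proof
  fix x
  note [measurable] = shift_boundedD(1)[OF h]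
  let ?e = "\<lambda>n. of_int (int_decode n) :: real"
  let ?f = "\<lambda>n u. a (int_decode n) * h (x - \<delta> * u - ?e n)"
  have int: "integrable std_exponential (?f n)" for n
    using shift_boundedD(3)[OF h] spec[OF a, of "int_decode n"] order_trans[OF abs_ge_zero spec[OF a]]
    by (intro integrable_std_exponential_bounded[of _ "A * B"]) (auto simp: abs_mult intro!: mult_mono)
  have eq: "(LINT u|std_exponential. ?f n u) = a (int_decode n) * exp_smooth \<delta> h (x - ?e n)" for n
    by (simp add: exp_smooth_def algebra_simps)
  \<comment> \<open>As \<open>h\<close> is nonnegative, the integrals of the norms are the norms of
    the terms of the averaged series, which is already known to converge absolutely.\<close>
  have "(LINT u|std_exponential. norm (?f n u)) = norm (a (int_decode n) * exp_smooth \<delta> h (x - ?e n))" for n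
    using shift_boundedD(2)[OF h] shift_boundedD(2)[OF shift_bounded_exp_smooth[OF h]]
    by (simp add: abs_mult exp_smooth_def algebra_simps)
  then have "summable (\<lambda>n. LINT u|std_exponential. norm (?f n u))"
    using real_shift_series_eq_suminf(1)[OF shift_bounded_exp_smooth[OF h] a] by simp
  then have "(LINT u|std_exponential. (\<Sum>n. ?f n u)) = (\<Sum>n. LINT u|std_exponential. ?f n u)"
    using real_shift_series_eq_suminf(1)[OF h a]
    by (intro integral_suminf[OF int] AE_I2)
  then show "real_shift_series (exp_smooth \<delta> h) a x = exp_smooth \<delta> (real_shift_series h a) x"
    unfolding eq exp_smooth_def[of \<delta> "real_shift_series h a"] real_shift_series_eq_suminf(2)[OF h a]
      real_shift_series_eq_suminf(2)[OF shift_bounded_exp_smooth[OF h] a] by simp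
qed

section \<open>Gaussian series as Laurent series\<close>

text \<open>The \<open>n\<close>-th term is the \<open>n\<close>-th power of
  \<open>exp (- \<gamma> * n) * r\<close>, which is eventually below 1/2.\<close>

lemma summable_gaussian_power:
  fixes \<gamma> r :: real
  assumes "\<gamma> > 0" "r \<ge> 0"
  shows "summable (\<lambda>n. exp (- \<gamma> * (real n)\<^sup>2) * r ^ n)"
proof (rule summable_comparison_test_ev[of _ "\<lambda>n. (1 / 2) ^ n"])
  have "(\<lambda>n. exp (- \<gamma> * real n) * r) \<longlonglongrightarrow> 0"
    using assms by real_asymp
  then have "eventually (\<lambda>n. exp (- \<gamma> * real n) * r < 1 / 2) sequentially"
    by (rule order_tendstoD) simp
  then show "eventually (\<lambda>n. norm (exp (- \<gamma> * (real n)\<^sup>2) * r ^ n) \<le> (1 / 2) ^ n) sequentially"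
  proof eventually_elim
    case (elim n)
    have "exp (- \<gamma> * (real n)\<^sup>2) * r ^ n = (exp (- \<gamma> * real n) * r) ^ n"
      by (simp add: power_mult_distrib exp_of_nat_mult[symmetric] power2_eq_square mult_ac)
    also have "\<dots> \<le> (1 / 2) ^ n"
      using elim assms by (intro power_mono) auto
    finally show ?case using assms by (simp add: abs_mult)
  qed
  show "summable (\<lambda>n. (1 / 2 :: real) ^ n)" by (rule summable_geometric) simp
qed

lemma entire_if_gaussian_coefficients:
  fixes b :: "nat \<Rightarrow> complex"
  assumes "\<gamma> > 0" "\<And>n. norm (b n) \<le> A * exp (- \<gamma> * (real n)\<^sup>2)"
  shows "(\<lambda>w. \<Sum>n. b n * w ^ n) holomorphic_on UNIV"
proof -
  have "(\<lambda>n. b n * (w - 0) ^ n) sums (\<Sum>n. b n * w ^ n)" for w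
  proof -
    have "summable (\<lambda>n. b n * w ^ n)"
    proof (rule summable_comparison_test[OF _ summable_mult[OF summable_gaussian_power[OF assms(1), of "norm w"], of A]])
      show "\<exists>N. \<forall>n\<ge>N. norm (b n * w ^ n) \<le> A * (exp (- \<gamma> * (real n)\<^sup>2) * norm w ^ n)"
        using mult_right_mono[OF assms(2), of "norm w ^ n" n for n]
        by (auto simp: norm_mult norm_power mult.assoc)
    qed simp
    then show ?thesis by (simp add: summable_sums)
  qed
  then have hol: "(\<lambda>w. \<Sum>n. b n * w ^ n) holomorphic_on ball 0 r" for r
    by (rule power_series_holomorphic)
  have "(\<lambda>w. \<Sum>n. b n * w ^ n) holomorphic_on (\<Union>r. ball 0 r)"
    by (rule holomorphic_on_UN_open) (auto intro: hol)
  moreover have "(\<Union>r. ball 0 r) = (UNIV :: complex set)"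
    using gt_ex by (auto simp: dist_norm)
  ultimately show ?thesis by simp
qed

lemma bij_betw_int_nonneg: "bij_betw int UNIV {0..}"
  by (rule bij_betw_byWitness[of _ nat]) auto

lemma bij_betw_int_neg: "bij_betw (\<lambda>n. - int n - 1) UNIV {..<0}"
  by (rule bij_betw_byWitness[of _ "\<lambda>k. nat (- k - 1)"]) auto

text \<open>Splits a Laurent series into two power series. The index \<open>- int n - 1\<close>
  starts the second at -1, so that 0 is counted once.\<close>

lemma infsum_int_split:
  fixes f :: "int \<Rightarrow> 'a :: banach"
  assumes "(\<lambda>k. norm (f k)) summable_on UNIV"
  shows "infsum f UNIV = (\<Sum>n. f (int n)) + (\<Sum>n. f (- int n - 1))"
proof -
  have s: "f summable_on A" for A
    by (rule summable_on_subset_banach[OF abs_summable_summable[OF assms] subset_UNIV])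
  have "infsum f ({0..} \<union> {..<0}) = infsum f {0..} + infsum f {..<0}"
    by (rule infsum_Un_disjoint[OF s s]) auto
  moreover have "{0..} \<union> {..<0} = (UNIV :: int set)" by auto
  moreover have "infsum f {0..} = (\<Sum>n. f (int n))"
    using s[of "{0..}"] summable_on_reindex_bij_betw[OF bij_betw_int_nonneg, of f]
    by (simp add: infsum_reindex_bij_betw[OF bij_betw_int_nonneg, of f, symmetric] suminf_eq_infsum_nat)
  moreover have "infsum f {..<0} = (\<Sum>n. f (- int n - 1))"
    using s[of "{..<0}"] summable_on_reindex_bij_betw[OF bij_betw_int_neg, of f]
    by (simp add: infsum_reindex_bij_betw[OF bij_betw_int_neg, of f, symmetric] suminf_eq_infsum_nat)
  ultimately show ?thesis by simp
qed

lemma summable_on_gaussian_int: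
  assumes "\<gamma> > 0"
  shows "(\<lambda>k::int. exp (- \<gamma> * (real_of_int k)\<^sup>2)) summable_on UNIV"
proof -
  have 1: "(\<lambda>n. exp (- \<gamma> * (real n)\<^sup>2)) summable_on UNIV"
    using summable_gaussian_power[OF assms, of 1] by (intro norm_summable_imp_summable_on) simp
  have "summable (\<lambda>n. exp (- \<gamma> * (real (Suc n))\<^sup>2))"
    using summable_gaussian_power[OF assms, of 1] by (subst summable_Suc_iff) simp
  then have 2: "(\<lambda>n. exp (- \<gamma> * (real (Suc n))\<^sup>2)) summable_on UNIV"
    by (intro norm_summable_imp_summable_on) simp
  have "(\<lambda>k::int. exp (- \<gamma> * (real_of_int k)\<^sup>2)) summable_on {0..}"
    using 1 by (subst summable_on_reindex_bij_betw[OF bij_betw_int_nonneg, symmetric]) simp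
  moreover have "(\<lambda>k::int. exp (- \<gamma> * (real_of_int k)\<^sup>2)) summable_on {..<0}"
    using 2 by (subst summable_on_reindex_bij_betw[OF bij_betw_int_neg, symmetric])
      (simp add: power2_eq_square algebra_simps)
  ultimately have "(\<lambda>k::int. exp (- \<gamma> * (real_of_int k)\<^sup>2)) summable_on {0..} \<union> {..<0}"
    by (rule summable_on_Un_disjoint) auto
  moreover have "{0..} \<union> {..<0} = (UNIV :: int set)" by auto
  ultimately show ?thesis by simp
qed

text \<open>Centring the summation at the integer part of \<open>x\<close> compares the shifted sum
  with a fixed convergent sum of Gaussians of half the exponent, at the cost of the factor
  \<open>exp \<gamma>\<close>.\<close>

lemma shift_bounded_gaussian:
  assumes "\<gamma> > 0"
  shows "\<exists>B. shift_bounded B (\<lambda>x. exp (- \<gamma> * x\<^sup>2))"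
proof -
  define \<theta> where "\<theta> = (\<lambda>k::int. exp (- (\<gamma> / 2) * (real_of_int k)\<^sup>2))"
  have \<theta>: "\<theta> summable_on UNIV"
    unfolding \<theta>_def using assms by (intro summable_on_gaussian_int) simp
  have "(\<Sum>k\<in>F. exp (- \<gamma> * (x - of_int k)\<^sup>2)) \<le> exp \<gamma> * infsum \<theta> UNIV"
    if F: "finite F" for F x
  proof -
    define y where "y = x - of_int \<lfloor>x\<rfloor>"
    have y: "0 \<le> y" "y \<le> 1" unfolding y_def by linarith+
    have le: "exp (- \<gamma> * (x - of_int k)\<^sup>2) \<le> exp \<gamma> * \<theta> (k - \<lfloor>x\<rfloor>)" for k
    proof -
      define j where "j = real_of_int (k - \<lfloor>x\<rfloor>)"
      have "y\<^sup>2 \<le> 1" using y by (simp add: power_le_one)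
      \<comment> \<open>Expanding this square gives
        \<open>(y - j)\<^sup>2 \<ge> j\<^sup>2 / 2 - y\<^sup>2\<close>.\<close>
      moreover have "0 \<le> (j / 2 - y)\<^sup>2 * 2" by simp
      ultimately have "j\<^sup>2 / 2 - 1 \<le> (y - j)\<^sup>2"
        by (simp add: power2_eq_square algebra_simps)
      then have "\<gamma> * (j\<^sup>2 / 2 - 1) \<le> \<gamma> * (y - j)\<^sup>2" using assms by (intro mult_left_mono) auto
      moreover have e: "x - of_int k = y - j" by (simp add: y_def j_def)
      ultimately have "- \<gamma> * (x - of_int k)\<^sup>2 \<le> \<gamma> + - (\<gamma> / 2) * j\<^sup>2"
        unfolding e by (simp add: algebra_simps)
      then show ?thesis
        unfolding \<theta>_def j_def[symmetric] exp_add[symmetric] by simp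
    qed
    have "(\<Sum>k\<in>F. exp (- \<gamma> * (x - of_int k)\<^sup>2)) \<le> (\<Sum>k\<in>F. exp \<gamma> * \<theta> (k - \<lfloor>x\<rfloor>))"
      by (intro sum_mono le)
    also have "\<dots> = exp \<gamma> * (\<Sum>k\<in>(\<lambda>k. k - \<lfloor>x\<rfloor>) ` F. \<theta> k)"
      by (simp add: sum_distrib_left sum.reindex inj_on_def)
    also have "\<dots> \<le> exp \<gamma> * infsum \<theta> UNIV"
      using F by (intro mult_left_mono finite_sum_le_infsum[OF \<theta>]) (auto simp: \<theta>_def)
    finally show ?thesis .
  qed
  then show ?thesis
    unfolding shift_bounded_def by (intro exI[of _ "exp \<gamma> * infsum \<theta> UNIV"]) auto
qed

text \<open>Expanding the square, \<open>exp (- \<gamma> * (x - k)\<^sup>2)\<close> is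
  \<open>exp (- \<gamma> * x\<^sup>2)\<close> times \<open>exp (- \<gamma> * k\<^sup>2)\<close>
  times the \<open>k\<close>-th power of \<open>exp (2 * \<gamma> * x)\<close>. Read backwards on
  absolute values, the same identity reduces the growth of \<open>F\<close> to the uniform bound for
  shifted Gaussians.\<close>

lemma gaussian_series_eq_Laurent_series:
  fixes a :: "int \<Rightarrow> real"
  assumes \<gamma>: "\<gamma> > 0" and a: "\<forall>k. \<bar>a k\<bar> \<le> A"
  obtains F C where "F holomorphic_on - {0}"
    "\<And>x w. norm w = exp (2 * \<gamma> * x) \<Longrightarrow> norm (F w) \<le> C * exp (\<gamma> * x\<^sup>2)"
    "\<And>x. of_real (real_shift_series (\<lambda>x. exp (- \<gamma> * x\<^sup>2)) a x)
       = of_real (exp (- \<gamma> * x\<^sup>2)) * F (of_real (exp (2 * \<gamma> * x)))"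
proof -
  obtain B where B: "shift_bounded B (\<lambda>x. exp (- \<gamma> * x\<^sup>2))"
    using shift_bounded_gaussian[OF \<gamma>] by blast
  define b where "b = (\<lambda>k::int. complex_of_real (a k * exp (- \<gamma> * (real_of_int k)\<^sup>2)))"
  define F where "F = (\<lambda>w. \<Sum>\<^sub>\<infinity>k. b k * w powi k)"
  have sq: "exp (- \<gamma> * (real_of_int k)\<^sup>2) * exp (2 * \<gamma> * x) powi k
      = exp (\<gamma> * x\<^sup>2) * exp (- \<gamma> * (x - of_int k)\<^sup>2)" for k x
  proof -
    have "exp (2 * \<gamma> * x) powi k = exp (of_int k * (2 * \<gamma> * x))"
      by (simp add: exp_power_int)
    moreover have "- \<gamma> * (real_of_int k)\<^sup>2 + of_int k * (2 * \<gamma> * x) = \<gamma> * x\<^sup>2 + - \<gamma> * (x - of_int k)\<^sup>2"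
      by (simp add: power2_eq_square algebra_simps)
    ultimately show ?thesis
      by (simp only: exp_add[symmetric])
  qed
  have norm_eq: "norm (b k * w powi k) = exp (\<gamma> * x\<^sup>2) * norm (a k * exp (- \<gamma> * (x - of_int k)\<^sup>2))"
    if "norm w = exp (2 * \<gamma> * x)" for w x k
  proof -
    have "norm (b k * w powi k) = \<bar>a k\<bar> * (exp (- \<gamma> * (real_of_int k)\<^sup>2) * exp (2 * \<gamma> * x) powi k)"
      by (simp add: b_def norm_mult norm_power_int that abs_mult)
    then show ?thesis unfolding sq by (simp add: abs_mult)
  qed
  have summ: "(\<lambda>k. norm (b k * w powi k)) summable_on UNIV" if "norm w = exp (2 * \<gamma> * x)" for w x
    unfolding norm_eq[OF that]
    using shift_series_abs_summable[OF B a, of x] by (intro summable_on_cmult_right)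
  have summ0: "(\<lambda>k. norm (b k * w powi k)) summable_on UNIV" if "w \<noteq> 0" for w
    \<comment> \<open>Every nonzero \<open>w\<close> has norm \<open>exp (2 * \<gamma> * x)\<close>
      for this \<open>x\<close>.\<close>
    using that \<gamma> by (intro summ[of _ "ln (norm w) / (2 * \<gamma>)"]) simp
  have "F holomorphic_on - {0}"
  proof -
    have 1: "(\<lambda>w. \<Sum>n. b (int n) * w ^ n) holomorphic_on UNIV"
      using a by (intro entire_if_gaussian_coefficients[OF \<gamma>, of _ A])
        (auto simp: b_def norm_mult abs_mult intro!: mult_right_mono)
    have 2: "(\<lambda>w. \<Sum>n. b (- int n - 1) * w ^ n) holomorphic_on UNIV"
    proof (rule entire_if_gaussian_coefficients[OF \<gamma>, of _ A])
      fix n :: nat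
      have "exp (- \<gamma> * (real_of_int (- int n - 1))\<^sup>2) \<le> exp (- \<gamma> * (real n)\<^sup>2)"
        using \<gamma> by (simp add: abs_le_square_iff[symmetric])
      then show "norm (b (- int n - 1)) \<le> A * exp (- \<gamma> * (real n)\<^sup>2)"
        using spec[OF a, of "- int n - 1"] by (auto simp: b_def norm_mult abs_mult intro!: mult_mono)
    qed
    \<comment> \<open>The principal part is an entire function evaluated at \<open>1 / w\<close>,
      with one factor \<open>1 / w\<close> taken out.\<close>
    have eq: "F w = (\<Sum>n. b (int n) * w ^ n) + 1 / w * (\<Sum>n. b (- int n - 1) * (1 / w) ^ n)" if "w \<noteq> 0" for w
    proof -
      have pw: "w powi (- int n - 1) = (1 / w) * (1 / w) ^ n" for n
        using that by (simp add: power_int_diff power_int_minus power_inverse divide_inverse)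
      then have "(\<Sum>n. b (- int n - 1) * w powi (- int n - 1)) = (\<Sum>n. 1 / w * (b (- int n - 1) * (1 / w) ^ n))"
        unfolding pw by (simp only: mult_ac)
      also have "\<dots> = 1 / w * (\<Sum>n. b (- int n - 1) * (1 / w) ^ n)"
      proof (rule suminf_mult)
        have "(\<lambda>k. b k * w powi k) summable_on {..<0}"
          by (rule summable_on_subset_banach[OF abs_summable_summable[OF summ0[OF that]] subset_UNIV])
        then have "summable (\<lambda>n. b (- int n - 1) * w powi (- int n - 1))"
          by (intro summable_on_imp_summable)
            (simp add: summable_on_reindex_bij_betw[OF bij_betw_int_neg, of "\<lambda>k. b k * w powi k"])
        then have "summable (\<lambda>n. 1 / w * (b (- int n - 1) * (1 / w) ^ n))"
          unfolding pw by (simp only: mult_ac)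
        then show "summable (\<lambda>n. b (- int n - 1) * (1 / w) ^ n)"
          using that by (simp only: summable_cmult_iff) simp
      qed
      finally show ?thesis
        unfolding F_def infsum_int_split[OF summ0[OF that]] by simp
    qed
    show ?thesis
      by (rule holomorphic_transform[OF _ eq[symmetric]])
        (auto intro!: holomorphic_intros holomorphic_on_compose_gen[OF _ 2, unfolded o_def] holomorphic_on_subset[OF 1])
  qed
  moreover have "norm (F w) \<le> A * B * exp (\<gamma> * x\<^sup>2)" if "norm w = exp (2 * \<gamma> * x)" for x w
  proof -
    have "norm (F w) \<le> (\<Sum>\<^sub>\<infinity>k. norm (b k * w powi k))"
      unfolding F_def by (rule norm_infsum_bound[OF summ[OF that]])
    also have "\<dots> = exp (\<gamma> * x\<^sup>2) * (\<Sum>\<^sub>\<infinity>k. norm (a k * exp (- \<gamma> * (x - of_int k)\<^sup>2)))"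
      unfolding norm_eq[OF that] by (rule infsum_cmult_right')
    also have "\<dots> \<le> exp (\<gamma> * x\<^sup>2) * (A * B)"
      by (intro mult_left_mono infsum_le_finite_sums[OF shift_series_abs_summable[OF B a]
            shift_bounded_partial_sums[OF B a]]) auto
    finally show ?thesis by (simp add: mult_ac)
  qed
  moreover have "of_real (real_shift_series (\<lambda>x. exp (- \<gamma> * x\<^sup>2)) a x)
       = of_real (exp (- \<gamma> * x\<^sup>2)) * F (of_real (exp (2 * \<gamma> * x)))" for x
  proof -
    have "complex_of_real (a k * exp (- \<gamma> * (x - of_int k)\<^sup>2))
        = of_real (exp (- \<gamma> * x\<^sup>2)) * (b k * of_real (exp (2 * \<gamma> * x)) powi k)" for k
    proof -
      have "exp (- \<gamma> * x\<^sup>2) * (exp (- \<gamma> * (real_of_int k)\<^sup>2) * exp (2 * \<gamma> * x) powi k)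
          = exp (- \<gamma> * (x - of_int k)\<^sup>2)"
        unfolding sq by (simp add: exp_add[symmetric] mult.assoc[symmetric])
      then have "a k * exp (- \<gamma> * (x - of_int k)\<^sup>2)
         = exp (- \<gamma> * x\<^sup>2) * (a k * exp (- \<gamma> * (real_of_int k)\<^sup>2) * exp (2 * \<gamma> * x) powi k)"
        by (simp add: mult_ac)
      then show ?thesis
        unfolding b_def by (metis of_real_mult of_real_power_int)
    qed
    then have "(\<Sum>\<^sub>\<infinity>k. complex_of_real (a k * exp (- \<gamma> * (x - of_int k)\<^sup>2)))
        = of_real (exp (- \<gamma> * x\<^sup>2)) * F (of_real (exp (2 * \<gamma> * x)))"
      unfolding F_def by (simp add: infsum_cmult_right')
    then show ?thesis
      using has_sum_of_real[OF has_sum_infsum[OF abs_summable_summable[OF shift_series_abs_summable[OF B a]]], where 'a = complex, of x]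
      by (simp add: real_shift_series_def infsumI)
  qed
  ultimately show ?thesis by (rule that)
qed

section \<open>Fourier transforms\<close>

text \<open>The integrand is \<open>exp (- \<omega> * u)\<close> with
  \<open>\<omega> = 1 + \<i> * s\<close>; since \<open>Re \<omega> = 1\<close>, its antiderivative
  vanishes at infinity.\<close>

lemma integral_exp_std_exponential:
  fixes s :: real
  shows "(LINT u|std_exponential. exp (- (\<i> * s * u))) = inverse (1 + \<i> * s)"
proof -
  define \<omega> where "\<omega> = 1 + \<i> * s"
  have \<omega>: "Re \<omega> = 1" "\<omega> \<noteq> 0" by (auto simp: \<omega>_def complex_eq_iff)
  let ?f = "\<lambda>u::real. exp (- (\<omega> * u))"
  \<comment> \<open>The density is 1 at \<open>u = 0\<close>, which the open interval leaves out;
    the integrands agree only almost everywhere.\<close>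
  have nonzero: "AE u in lborel. u \<noteq> (0::real)" by (rule AE_lborel_singleton)
  have eq: "AE u in lborel. exponential_density 1 u *\<^sub>R exp (- (\<i> * s * u)) = indicator (einterval 0 \<infinity>) u *\<^sub>R ?f u"
    using nonzero
  proof eventually_elim
    case (elim u)
    have "complex_of_real (exp (- u)) * exp (- (\<i> * s * u)) = ?f u"
      by (simp add: \<omega>_def exp_of_real[symmetric] exp_add[symmetric] algebra_simps)
    with elim show ?case
      by (auto simp: exponential_density_def indicator_def einterval_def scaleR_conv_of_real)
  qed
  have [measurable]: "einterval 0 \<infinity> \<in> sets borel" by simp
  have "integrable std_exponential (\<lambda>u. exp (- (\<i> * s * u)))"
    by (rule integrable_std_exponential_bounded[of _ 1]) (auto simp: norm_exp_eq_Re)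
  then have "integrable lborel (\<lambda>u. exponential_density 1 u *\<^sub>R exp (- (\<i> * s * u)))"
    by (subst (asm) integrable_density) (auto intro!: exponential_density_nonneg)
  then have int: "set_integrable lborel (einterval 0 \<infinity>) ?f"
    unfolding set_integrable_def by (subst (asm) integrable_cong_AE[OF _ _ eq]) auto
  have "(LINT u|std_exponential. exp (- (\<i> * s * u)))
      = (LINT u|lborel. exponential_density 1 u *\<^sub>R exp (- (\<i> * s * u)))"
    by (rule integral_std_exponential) simp
  also have "\<dots> = (LBINT u=0..\<infinity>. ?f u)"
    unfolding interval_lebesgue_integral_def set_lebesgue_integral_def
    using eq by (simp, intro integral_cong_AE) auto
  also have "\<dots> = 0 - (- inverse \<omega>)"
  proof (rule interval_integral_FTC_integrable[OF _ _ _ int])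
    show "((\<lambda>u. - inverse \<omega> * exp (- (\<omega> * of_real u))) has_vector_derivative ?f u) (at u)" for u
    proof -
      have "((\<lambda>z. - inverse \<omega> * exp (- (\<omega> * z))) has_field_derivative ?f u) (at (of_real u))"
        using \<omega> by (auto intro!: derivative_eq_intros)
      from has_vector_derivative_real_field[OF this] show ?thesis .
    qed
    show "isCont ?f u" for u by (intro continuous_intros)
    have "((\<lambda>u. - inverse \<omega> * exp (- (\<omega> * of_real u))) \<longlongrightarrow> - inverse \<omega> * exp (- (\<omega> * of_real 0))) (at_right 0)"
      by (intro tendsto_intros)
    then show "(((\<lambda>u. - inverse \<omega> * exp (- (\<omega> * of_real u))) \<circ> real_of_ereal) \<longlongrightarrow> - inverse \<omega>) (at_right 0)"
      by (simp add: zero_ereal_def ereal_tendsto_simps1)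
    have "((\<lambda>u. norm (inverse \<omega>) * exp (- u)) \<longlongrightarrow> norm (inverse \<omega>) * 0) (at_top :: real filter)"
      by (intro tendsto_intros filterlim_compose[OF exp_at_bot] filterlim_uminus_at_bot_at_top)
    then have "((\<lambda>u. norm (- inverse \<omega> * exp (- (\<omega> * of_real u)))) \<longlongrightarrow> 0) (at_top :: real filter)"
      using \<omega> by (simp add: norm_mult norm_exp_eq_Re)
    then have "((\<lambda>u. - inverse \<omega> * exp (- (\<omega> * of_real u))) \<longlongrightarrow> 0) (at_top :: real filter)"
      by (rule tendsto_norm_zero_cancel)
    then show "(((\<lambda>u. - inverse \<omega> * exp (- (\<omega> * of_real u))) \<circ> real_of_ereal) \<longlongrightarrow> 0) (at_left \<infinity>)"
      by (simp add: ereal_tendsto_simps1)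
  qed simp
  finally show ?thesis by (simp add: \<omega>_def)
qed

abbreviation wave :: "real \<Rightarrow> real \<Rightarrow> complex" where
  "wave \<xi> x \<equiv> exp (- (2 * of_real pi * \<i> * of_real x * of_real \<xi>))"

lemma norm_wave: "norm (wave \<xi> x) = 1"
  by (simp add: norm_exp_eq_Re)

lemma wave_add: "wave \<xi> (x + y) = wave \<xi> x * wave \<xi> y"
  by (simp add: exp_add[symmetric] algebra_simps)

text \<open>By Fubini's theorem the transform is taken before the average. Translation by
  \<open>\<delta> * u\<close> multiplies it by a wave in \<open>u\<close>, and averaging that wave
  gives the inverse factor.\<close>

lemma
  assumes [measurable]: "h \<in> borel_measurable borel" and nonneg: "\<And>x. 0 \<le> h x"
    and bnd: "\<And>x. \<bar>h x\<bar> \<le> B" and int: "integrable lborel h"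
  shows fourier_transform_exp_smooth:
      "fourier_transform (\<lambda>x. of_real (exp_smooth \<delta> h x)) \<xi>
        = fourier_transform (\<lambda>x. of_real (h x)) \<xi> * inverse (1 + 2 * of_real pi * \<i> * of_real \<delta> * of_real \<xi>)"
    and integrable_exp_smooth: "integrable lborel (exp_smooth \<delta> h)"
proof -
  interpret E: prob_space std_exponential by (rule prob_space_std_exponential)
  interpret P: pair_sigma_finite std_exponential lborel ..
  have shift: "integrable lborel (\<lambda>x. h (x - t))" "(LINT x|lborel. h (x - t)) = (LINT x|lborel. h x)" for t
    using lborel_integrable_real_affine[OF int, of 1 "- t"] lborel_integral_real_affine[of 1 h "- t"]
    by simp_all
  have int_wave: "integrable lborel (\<lambda>x. complex_of_real (h (x - t)) * wave \<xi> x)" for t \<xi>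
    by (rule Bochner_Integration.integrable_bound[OF shift(1)[of t]]) (auto simp: norm_mult norm_wave)
  have intP: "integrable (std_exponential \<Otimes>\<^sub>M lborel) (\<lambda>(u, x). complex_of_real (h (x - \<delta> * u)) * wave \<xi> x)" for \<xi>
  proof (rule P.Fubini_integrable)
    show "AE u in std_exponential. integrable lborel (\<lambda>y. case (u, y) of (u, x) \<Rightarrow> complex_of_real (h (x - \<delta> * u)) * wave \<xi> x)"
      using int_wave by simp
    show "integrable std_exponential (\<lambda>u. LINT y|lborel. norm (case (u, y) of (u, x) \<Rightarrow> complex_of_real (h (x - \<delta> * u)) * wave \<xi> x))"
      using nonneg by (simp add: norm_mult norm_wave shift(2))
  qed measurable
  have inner: "(LINT u|std_exponential. complex_of_real (h (x - \<delta> * u)) * wave \<xi> x) = of_real (exp_smooth \<delta> h x) * wave \<xi> x" for x \<xi>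
    by (simp add: exp_smooth_def)
  have outer: "(LINT x|lborel. complex_of_real (h (x - \<delta> * u)) * wave \<xi> x)
      = fourier_transform (\<lambda>x. of_real (h x)) \<xi> * exp (- (\<i> * (2 * pi * \<delta> * \<xi>) * u))" for u
  proof -
    have "(LINT x|lborel. complex_of_real (h (x - \<delta> * u)) * wave \<xi> x)
        = (LINT x|lborel. complex_of_real (h x) * wave \<xi> (\<delta> * u + x))"
      by (subst lborel_integral_real_affine[of 1 _ "\<delta> * u"]) simp_all
    also have "\<dots> = (LINT x|lborel. complex_of_real (h x) * wave \<xi> x * wave \<xi> (\<delta> * u))"
      unfolding wave_add by (simp only: mult_ac)
    also have "\<dots> = fourier_transform (\<lambda>x. of_real (h x)) \<xi> * wave \<xi> (\<delta> * u)"
      by (simp add: fourier_transform_def)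
    finally show ?thesis by (simp add: mult_ac)
  qed
  have "fourier_transform (\<lambda>x. of_real (exp_smooth \<delta> h x)) \<xi>
      = (LINT x|lborel. LINT u|std_exponential. complex_of_real (h (x - \<delta> * u)) * wave \<xi> x)"
    unfolding inner by (simp add: fourier_transform_def)
  also have "\<dots> = (LINT u|std_exponential. LINT x|lborel. complex_of_real (h (x - \<delta> * u)) * wave \<xi> x)"
    by (rule P.Fubini_integral[OF intP])
  also have "\<dots> = fourier_transform (\<lambda>x. of_real (h x)) \<xi> * (LINT u|std_exponential. exp (- (\<i> * (2 * pi * \<delta> * \<xi>) * u)))"
    unfolding outer by simp
  also have "(LINT u|std_exponential. exp (- (\<i> * (2 * pi * \<delta> * \<xi>) * u))) = inverse (1 + 2 * of_real pi * \<i> * of_real \<delta> * of_real \<xi>)"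
    using integral_exp_std_exponential[of "2 * pi * \<delta> * \<xi>"] by (simp add: mult_ac)
  finally show "fourier_transform (\<lambda>x. of_real (exp_smooth \<delta> h x)) \<xi>
        = fourier_transform (\<lambda>x. of_real (h x)) \<xi> * inverse (1 + 2 * of_real pi * \<i> * of_real \<delta> * of_real \<xi>)" .
  \<comment> \<open>At frequency 0 the wave is constantly 1, so Fubini's theorem yields
    integrability of the average itself.\<close>
  have "integrable lborel (\<lambda>x. LINT u|std_exponential. complex_of_real (h (x - \<delta> * u)) * wave 0 x)"
    by (rule P.integrable_snd[OF intP])
  then have "integrable lborel (\<lambda>x. complex_of_real (exp_smooth \<delta> h x))"
    unfolding inner by simp
  then show "integrable lborel (exp_smooth \<delta> h)"
    by (simp add: complex_of_real_integrable_eq)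
qed

text \<open>Rescaling by \<open>\<sigma>\<close> leads to the characteristic function of the
  standard normal law; \<open>t\<close> carries the minus sign and the factor \<open>2 * pi\<close>
  by which the two conventions differ.\<close>

lemma fourier_transform_normal_density:
  assumes "\<sigma> > 0"
  shows "fourier_transform (\<lambda>x. of_real (normal_density 0 \<sigma> x)) \<xi> = of_real (exp (- (2 * pi\<^sup>2 * \<sigma>\<^sup>2) * \<xi>\<^sup>2))"
proof -
  define t where "t = - (2 * pi * \<sigma> * \<xi>)"
  have "fourier_transform (\<lambda>x. of_real (normal_density 0 \<sigma> x)) \<xi>
      = \<bar>\<sigma>\<bar> *\<^sub>R (LINT x|lborel. of_real (normal_density 0 \<sigma> (\<sigma> * x)) * wave \<xi> (\<sigma> * x))"
    unfolding fourier_transform_def using assms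
    by (subst lborel_integral_real_affine[of \<sigma> _ 0]) simp_all
  also have "\<dots> = (LINT x|lborel. \<sigma> *\<^sub>R (of_real (normal_density 0 \<sigma> (\<sigma> * x)) * wave \<xi> (\<sigma> * x)))"
    using assms by simp
  also have "\<dots> = (LINT x|lborel. std_normal_density x *\<^sub>R iexp (t * x))"
  proof (intro Bochner_Integration.integral_cong refl)
    fix x
    have "\<sigma> * normal_density 0 \<sigma> (\<sigma> * x) = std_normal_density x"
      using assms by (simp add: normal_density_def real_sqrt_mult power_mult_distrib)
    moreover have "wave \<xi> (\<sigma> * x) = iexp (t * x)"
      by (simp add: t_def mult_ac)
    ultimately show "\<sigma> *\<^sub>R (of_real (normal_density 0 \<sigma> (\<sigma> * x)) * wave \<xi> (\<sigma> * x)) = std_normal_density x *\<^sub>R iexp (t * x)"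
      by (metis of_real_mult scaleR_conv_of_real mult.assoc)
  qed
  also have "\<dots> = char std_normal_distribution t"
    unfolding char_def by (subst integral_density) auto
  also have "\<dots> = of_real (exp (- (2 * pi\<^sup>2 * \<sigma>\<^sup>2) * \<xi>\<^sup>2))"
    unfolding char_std_normal_distribution by (simp add: t_def power2_eq_square mult_ac)
  finally show ?thesis .
qed

section \<open>Uniqueness of the Fourier transform\<close>

text \<open>The positive and negative parts of \<open>r\<close> have equal transforms, hence equal
  mass \<open>m\<close> by taking \<open>t = 0\<close>. If \<open>m > 0\<close>, dividing by it
  gives two probability densities with one characteristic function, and Levy's uniqueness theorem
  applies.\<close>

lemma AE_zero_if_fourier_zero:
  fixes r :: "real \<Rightarrow> real"
  assumes r: "integrable lborel r" and zero: "\<And>t. (LINT x|lborel. of_real (r x) * iexp (t * x)) = 0"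
  shows "AE x in lborel. r x = 0"
proof -
  have [measurable]: "r \<in> borel_measurable borel" using r by simp
  define p q where "p = (\<lambda>x. max 0 (r x))" and "q = (\<lambda>x. max 0 (- r x))"
  have [measurable]: "p \<in> borel_measurable borel" "q \<in> borel_measurable borel"
    unfolding p_def q_def by measurable
  have nonneg: "0 \<le> p x" "0 \<le> q x" for x by (auto simp: p_def q_def)
  have r_eq: "r x = p x - q x" for x by (auto simp: p_def q_def)
  have int: "integrable lborel p" "integrable lborel q"
    unfolding p_def q_def using r by (auto intro!: integrable_max)
  have int_exp: "integrable lborel (\<lambda>x. complex_of_real (p x) * iexp (t * x))"
                "integrable lborel (\<lambda>x. complex_of_real (q x) * iexp (t * x))" for t
    by (rule Bochner_Integration.integrable_bound[OF int(1)], simp_all add: norm_mult)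
      (rule Bochner_Integration.integrable_bound[OF int(2)], simp_all add: norm_mult)
  have eq: "(LINT x|lborel. of_real (p x) * iexp (t * x)) = (LINT x|lborel. of_real (q x) * iexp (t * x))" for t
    using zero[of t] unfolding r_eq of_real_diff left_diff_distrib
    by (subst (asm) Bochner_Integration.integral_diff[OF int_exp]) simp
  define m where "m = (LINT x|lborel. p x)"
  have m: "(LINT x|lborel. q x) = m"
    using eq[of 0] by (simp add: m_def)
  show ?thesis
  proof (cases "m = 0")
    case True
    have "AE x in lborel. p x = 0" "AE x in lborel. q x = 0"
      using integral_nonneg_eq_0_iff_AE[OF int(1)] integral_nonneg_eq_0_iff_AE[OF int(2)] nonneg m True
      by (auto simp: m_def)
    then show ?thesis by eventually_elim (simp add: r_eq)
  next
    case False
    have "m \<ge> 0" unfolding m_def using nonneg by (intro integral_nonneg_AE) auto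
    with False have m0: "m > 0" by simp
    have dist: "real_distribution (density lborel (\<lambda>x. ennreal (f x / m)))"
      and char: "char (density lborel (\<lambda>x. ennreal (f x / m))) t = (LINT x|lborel. of_real (f x) * iexp (t * x)) / m"
      if [measurable]: "f \<in> borel_measurable borel" and f: "\<And>x. 0 \<le> f x" "integrable lborel f" "(LINT x|lborel. f x) = m"
      for f :: "real \<Rightarrow> real" and t
    proof -
      have "prob_space (density lborel (\<lambda>x. ennreal (f x / m)))"
      proof
        have "emeasure (density lborel (\<lambda>x. ennreal (f x / m))) UNIV = (\<integral>\<^sup>+x. ennreal (f x / m) \<partial>lborel)"
          by (subst emeasure_density) auto
        also have "\<dots> = ennreal (LINT x|lborel. f x / m)"
          using f m0 by (intro nn_integral_eq_integral) auto
        also have "\<dots> = 1" using f m0 by simp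
        finally show "emeasure (density lborel (\<lambda>x. ennreal (f x / m))) (space (density lborel (\<lambda>x. ennreal (f x / m)))) = 1"
          by simp
      qed
      then show "real_distribution (density lborel (\<lambda>x. ennreal (f x / m)))"
        by (simp add: real_distribution_def real_distribution_axioms_def)
      have "char (density lborel (\<lambda>x. ennreal (f x / m))) t = (LINT x|lborel. (f x / m) *\<^sub>R iexp (t * x))"
        unfolding char_def using f m0 by (subst integral_density) auto
      also have "\<dots> = (LINT x|lborel. of_real (f x) * iexp (t * x) / m)"
        by (simp add: scaleR_conv_of_real)
      also have "\<dots> = (LINT x|lborel. of_real (f x) * iexp (t * x)) / m"
        by (rule integral_divide_zero)
      finally show "char (density lborel (\<lambda>x. ennreal (f x / m))) t = (LINT x|lborel. of_real (f x) * iexp (t * x)) / m" .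
    qed
    have "density lborel (\<lambda>x. ennreal (p x / m)) = density lborel (\<lambda>x. ennreal (q x / m))"
    proof (intro Levy_uniqueness dist ext)
      show "char (density lborel (\<lambda>x. ennreal (p x / m))) t = char (density lborel (\<lambda>x. ennreal (q x / m))) t" for t
        using char[of p t] char[of q t] nonneg int m eq[of t] by (simp add: m_def)
    qed (use nonneg int m in \<open>simp_all add: m_def\<close>)
    then have "AE x in lborel. ennreal (p x / m) = ennreal (q x / m)"
      by (intro sigma_finite_measure.density_unique[OF sigma_finite_lborel]) auto
    then show ?thesis
      by eventually_elim (use nonneg m0 in \<open>simp add: r_eq\<close>)
  qed
qed

lemma continuous_AE_zero_imp_zero:
  fixes h :: "real \<Rightarrow> 'a :: real_normed_vector"
  assumes "continuous_on UNIV h" "AE x in lborel. h x = 0"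
  shows "h x = 0"
proof (rule ccontr)
  assume "h x \<noteq> 0"
  have op: "open {x. h x \<noteq> 0}"
    using assms(1) by (intro open_Collect_neq continuous_intros) auto
  have "{x. h x \<noteq> 0} \<in> null_sets lborel"
    using assms(2) op AE_iff_null[of lborel "\<lambda>x. h x = 0"] by simp
  moreover obtain e where "e > 0" "ball x e \<subseteq> {x. h x \<noteq> 0}"
    using op \<open>h x \<noteq> 0\<close> openE by blast
  ultimately have "ball x e \<in> null_sets lborel"
    by (intro null_sets_subset[of "{x. h x \<noteq> 0}" lborel "ball x e"]) auto
  then show False
    using \<open>e > 0\<close> by (simp add: null_sets_def ball_eq_greaterThanLessThan)
qed

text \<open>The uniqueness result for real functions is applied to the real and imaginary parts of
  the difference; continuity then removes the exceptional null set.\<close>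

lemma fourier_transform_eq_imp_eq:
  fixes g h :: "real \<Rightarrow> complex"
  assumes g: "continuous_on UNIV g" "integrable lborel g"
    and h: "continuous_on UNIV h" "integrable lborel h"
    and eq: "\<And>\<xi>. fourier_transform g \<xi> = fourier_transform h \<xi>"
  shows "g = h"
proof -
  define d where "d = (\<lambda>x. g x - h x)"
  have d: "continuous_on UNIV d" "integrable lborel d"
    unfolding d_def using g h by (auto intro!: continuous_intros)
  have [measurable]: "d \<in> borel_measurable borel" using d(2) by simp
  have int: "integrable lborel (\<lambda>x. d x * iexp (t * x))" for t
    by (rule Bochner_Integration.integrable_bound[OF d(2)]) (auto simp: norm_mult)
  have zero: "(LINT x|lborel. d x * iexp (t * x)) = 0" for t
  proof -
    define \<xi> where "\<xi> = - t / (2 * pi)"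
    have e: "iexp (t * x) = wave \<xi> x" for x
      by (simp add: \<xi>_def mult_ac)
    have "integrable lborel (\<lambda>x. g x * wave \<xi> x)" "integrable lborel (\<lambda>x. h x * wave \<xi> x)"
      by (rule Bochner_Integration.integrable_bound[OF g(2)], use g(2) in \<open>simp_all add: norm_mult norm_wave\<close>)
        (rule Bochner_Integration.integrable_bound[OF h(2)], use h(2) in \<open>simp_all add: norm_mult norm_wave\<close>)
    then show ?thesis
      using eq[of \<xi>] unfolding e d_def fourier_transform_def left_diff_distrib
      by (subst Bochner_Integration.integral_diff) auto
  qed
  \<comment> \<open>The transform of the conjugate at \<open>t\<close> is the conjugate of the
    transform at \<open>- t\<close>, so it vanishes as well; this separates the real and imaginary
    parts.\<close>
  have cnj_zero: "(LINT x|lborel. cnj (d x) * iexp (t * x)) = 0" for t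
  proof -
    have "(LINT x|lborel. cnj (d x) * iexp (t * x)) = (LINT x|lborel. cnj (d x * iexp ((- t) * x)))"
      by (simp add: exp_cnj)
    also have "\<dots> = cnj (LINT x|lborel. d x * iexp ((- t) * x))" by (rule Bochner_Integration.integral_cnj)
    also have "\<dots> = 0" by (simp only: zero complex_cnj_zero)
    finally show ?thesis .
  qed
  have [measurable]: "(\<lambda>x. cnj (d x)) \<in> borel_measurable borel"
    by (intro borel_measurable_continuous_onI continuous_intros d(1))
  have int_cnj: "integrable lborel (\<lambda>x. cnj (d x) * iexp (t * x))" for t
    by (rule Bochner_Integration.integrable_bound[OF d(2)]) (auto simp: norm_mult)
  have "(LINT x|lborel. of_real (Re (d x)) * iexp (t * x)) = 0" for t
  proof -
    have "(LINT x|lborel. of_real (Re (d x)) * iexp (t * x)) = (LINT x|lborel. (d x * iexp (t * x) + cnj (d x) * iexp (t * x)) / 2)"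
      by (intro Bochner_Integration.integral_cong refl) (simp add: distrib_right[symmetric] complex_add_cnj)
    also have "\<dots> = 0"
      using int int_cnj zero cnj_zero by simp
    finally show ?thesis .
  qed
  then have re: "AE x in lborel. Re (d x) = 0"
    using d(2) by (intro AE_zero_if_fourier_zero) auto
  have "(LINT x|lborel. of_real (Im (d x)) * iexp (t * x)) = 0" for t
  proof -
    have "(LINT x|lborel. of_real (Im (d x)) * iexp (t * x)) = (LINT x|lborel. (d x * iexp (t * x) - cnj (d x) * iexp (t * x)) / (2 * \<i>))"
      by (intro Bochner_Integration.integral_cong refl) (simp add: left_diff_distrib[symmetric] complex_diff_cnj field_simps)
    also have "\<dots> = 0"
      using int int_cnj zero cnj_zero by simp
    finally show ?thesis .
  qed
  then have im: "AE x in lborel. Im (d x) = 0"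
    using d(2) by (intro AE_zero_if_fourier_zero) auto
  have "AE x in lborel. d x = 0"
    using re im by eventually_elim (simp add: complex_eq_iff)
  then show ?thesis
    using continuous_AE_zero_imp_zero[OF d(1)] by (auto simp: d_def)
qed

section \<open>Shift series of Gaussian type\<close>

text \<open>A concrete model of \<open>g\<close>, one averaging per factor of the transform;
  \<open>\<delta> (Suc n)\<close> matches the product over \<open>j=1..n\<close>.\<close>

primrec gaussian_type_kernel :: "real \<Rightarrow> (nat \<Rightarrow> real) \<Rightarrow> nat \<Rightarrow> real \<Rightarrow> real" where
  "gaussian_type_kernel \<sigma> \<delta> 0 = normal_density 0 \<sigma>"
| "gaussian_type_kernel \<sigma> \<delta> (Suc n) = exp_smooth (\<delta> (Suc n)) (gaussian_type_kernel \<sigma> \<delta> n)"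

lemma normal_density_eq_scaled_gaussian:
  "normal_density 0 \<sigma> x = 1 / sqrt (2 * pi * \<sigma>\<^sup>2) * exp (- (1 / (2 * \<sigma>\<^sup>2)) * x\<^sup>2)"
  by (simp add: normal_density_def)

lemma shift_bounded_cmult:
  assumes "shift_bounded B h" "0 \<le> C"
  shows "shift_bounded (C * B) (\<lambda>x. C * h x)"
  using assms unfolding shift_bounded_def
  by (auto simp: sum_distrib_left[symmetric] intro!: mult_left_mono)

lemma shift_bounded_gaussian_type_kernel:
  assumes "\<sigma> > 0"
  obtains B where "\<And>n. shift_bounded B (gaussian_type_kernel \<sigma> \<delta> n)"
proof -
  obtain B where "shift_bounded B (\<lambda>x. exp (- (1 / (2 * \<sigma>\<^sup>2)) * x\<^sup>2))"
    using shift_bounded_gaussian[of "1 / (2 * \<sigma>\<^sup>2)"] assms by auto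
  from shift_bounded_cmult[OF this, of "1 / sqrt (2 * pi * \<sigma>\<^sup>2)"]
  have "shift_bounded (1 / sqrt (2 * pi * \<sigma>\<^sup>2) * B) (normal_density 0 \<sigma>)"
    unfolding normal_density_eq_scaled_gaussian[abs_def] by simp
  then have "shift_bounded (1 / sqrt (2 * pi * \<sigma>\<^sup>2) * B) (gaussian_type_kernel \<sigma> \<delta> n)" for n
    by (induction n) (simp_all add: shift_bounded_exp_smooth)
  then show ?thesis by (rule that)
qed

text \<open>The three properties go through one induction, because transforming a further average
  needs the integrability of the previous kernel.\<close>

lemma gaussian_type_kernel_fourier:
  assumes "\<sigma> > 0"
  shows "continuous_on UNIV (gaussian_type_kernel \<sigma> \<delta> n) \<and> integrable lborel (gaussian_type_kernel \<sigma> \<delta> n) \<and>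
    (\<forall>\<xi>. fourier_transform (\<lambda>x. of_real (gaussian_type_kernel \<sigma> \<delta> n x)) \<xi> =
      (\<Prod>j=1..n. inverse (1 + 2 * of_real pi * \<i> * of_real (\<delta> j) * of_real \<xi>))
        * of_real (exp (- (2 * pi\<^sup>2 * \<sigma>\<^sup>2) * \<xi>\<^sup>2)))"
proof (induction n)
  case 0
  have "continuous_on UNIV (normal_density 0 \<sigma>)"
    unfolding normal_density_def using assms by (intro continuous_intros) auto
  then show ?case
    using assms fourier_transform_normal_density[OF assms] by simp
next
  case (Suc n)
  obtain B where B: "\<And>n. shift_bounded B (gaussian_type_kernel \<sigma> \<delta> n)"
    using shift_bounded_gaussian_type_kernel[OF assms] by blast
  note sb = shift_boundedD(1-3)[OF B[of n]]
  have "continuous_on UNIV (gaussian_type_kernel \<sigma> \<delta> (Suc n))"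
    using Suc by (simp add: continuous_exp_smooth[OF _ sb(3)])
  moreover have "integrable lborel (gaussian_type_kernel \<sigma> \<delta> (Suc n))"
    using Suc by (auto intro: integrable_exp_smooth[OF sb])
  moreover have "fourier_transform (\<lambda>x. of_real (gaussian_type_kernel \<sigma> \<delta> (Suc n) x)) \<xi> =
      (\<Prod>j=1..Suc n. inverse (1 + 2 * of_real pi * \<i> * of_real (\<delta> j) * of_real \<xi>))
        * of_real (exp (- (2 * pi\<^sup>2 * \<sigma>\<^sup>2) * \<xi>\<^sup>2))" for \<xi>
    using Suc fourier_transform_exp_smooth[OF sb, of "\<delta> (Suc n)" \<xi>] by (simp add: mult_ac)
  ultimately show ?case by blast
qed

lemma gaussian_type_eq_kernel:
  assumes "totally_positive_gaussian_type g"
  obtains \<sigma> \<delta> n where "\<sigma> > 0" "g = (\<lambda>x. of_real (gaussian_type_kernel \<sigma> \<delta> n x))"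
proof -
  obtain n :: nat and \<delta> :: "nat \<Rightarrow> real" and c :: real
    where g: "continuous_on UNIV g" "integrable lborel g" and c: "c > 0"
    and F: "\<And>\<xi>. fourier_transform g \<xi> =
        (\<Prod>j=1..n. inverse (1 + 2 * of_real pi * \<i> * of_real (\<delta> j) * of_real \<xi>)) * of_real (exp (- c * \<xi>\<^sup>2))"
    using assms unfolding totally_positive_gaussian_type_def by blast
  \<comment> \<open>Chosen so that \<open>2 * pi\<^sup>2 * \<sigma>\<^sup>2 = c\<close>, the
    exponent in the transform of the normal density.\<close>
  define \<sigma> where "\<sigma> = sqrt (c / (2 * pi\<^sup>2))"
  have \<sigma>: "\<sigma> > 0" using c by (simp add: \<sigma>_def)
  have c_eq: "2 * pi\<^sup>2 * \<sigma>\<^sup>2 = c" using c by (simp add: \<sigma>_def)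
  note K = gaussian_type_kernel_fourier[OF \<sigma>, of \<delta> n, unfolded c_eq]
  have "g = (\<lambda>x. of_real (gaussian_type_kernel \<sigma> \<delta> n x))"
  proof (rule fourier_transform_eq_imp_eq[OF g])
    show "continuous_on UNIV (\<lambda>x. complex_of_real (gaussian_type_kernel \<sigma> \<delta> n x))"
      using K by (intro continuous_intros) auto
    show "integrable lborel (\<lambda>x. complex_of_real (gaussian_type_kernel \<sigma> \<delta> n x))"
      using K by (intro integrable_of_real) auto
  qed (use K F in simp)
  with \<sigma> show ?thesis by (rule that)
qed

text \<open>Both claims are read off from the Laurent series: continuity on the real line, and
  vanishing from the growth argument with windows of length \<open>2 * R\<close>.\<close>

lemma real_shift_series_normal_density:
  fixes a :: "int \<Rightarrow> real"
  assumes \<sigma>: "\<sigma> > 0" and a: "\<forall>k. \<bar>a k\<bar> \<le> A"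
  shows continuous_real_shift_series_normal_density:
      "continuous_on UNIV (real_shift_series (normal_density 0 \<sigma>) a)"
    and real_shift_series_normal_density_eq_0:
      "0 < R \<Longrightarrow> 2 * R + 1 < real M \<Longrightarrow> zeros_in_windows M R (real_shift_series (normal_density 0 \<sigma>) a) \<Longrightarrow>
        real_shift_series (normal_density 0 \<sigma>) a x = 0"
proof -
  define \<gamma> where "\<gamma> = 1 / (2 * \<sigma>\<^sup>2)"
  have \<gamma>: "\<gamma> > 0" using \<sigma> by (simp add: \<gamma>_def)
  define s where "s = 1 / sqrt (2 * pi * \<sigma>\<^sup>2)"
  have s: "s > 0" using \<sigma> by (simp add: s_def)
  let ?h = "real_shift_series (normal_density 0 \<sigma>) a"
  obtain F C where F: "F holomorphic_on - {0}"
    and growth: "\<And>x w. norm w = exp (2 * \<gamma> * x) \<Longrightarrow> norm (F w) \<le> C * exp (\<gamma> * x\<^sup>2)"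
    and series: "\<And>x. of_real (real_shift_series (\<lambda>x. exp (- \<gamma> * x\<^sup>2)) a x)
       = of_real (exp (- \<gamma> * x\<^sup>2)) * F (of_real (exp (2 * \<gamma> * x)))"
    using gaussian_series_eq_Laurent_series[OF \<gamma> a] by blast
  have h: "?h x = s * real_shift_series (\<lambda>x. exp (- \<gamma> * x\<^sup>2)) a x" for x
    unfolding real_shift_series_def normal_density_eq_scaled_gaussian \<gamma>_def[symmetric] s_def[symmetric]
    by (subst infsum_cmult_right'[symmetric]) (simp add: mult_ac)
  have hF: "complex_of_real (?h x) = of_real (s * exp (- \<gamma> * x\<^sup>2)) * F (of_real (exp (2 * \<gamma> * x)))" for x
    unfolding h of_real_mult series by simp
  have "continuous_on UNIV (\<lambda>x. F (of_real (exp (2 * \<gamma> * x))))"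
    by (rule continuous_on_compose2[OF holomorphic_on_imp_continuous_on[OF F]]) (auto intro!: continuous_intros)
  then have "continuous_on UNIV (\<lambda>x. Re (complex_of_real (?h x)))"
    unfolding hF by (intro continuous_intros)
  then show "continuous_on UNIV ?h" by simp
  assume R: "0 < R" "2 * R + 1 < real M" and zeros: "zeros_in_windows M R ?h"
  \<comment> \<open>Adjacent closed windows share an endpoint. Dropping the right endpoint costs at
    most one zero and makes the windows disjoint, which explains the \<open>+ 1\<close> in the
    assumption on \<open>M\<close>.\<close>
  define m where "m = M - 1"
  have m: "2 * R < real m" using R by (simp add: m_def of_nat_diff)
  have "\<exists>Z. finite Z \<and> card Z = m \<and> Z \<subseteq> {k * (2 * R)..<(k + 1) * (2 * R)} \<and> (\<forall>z\<in>Z. ?h z = 0)" for k :: real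
  proof -
    obtain Z where Z: "Z \<subseteq> {(2 * k + 1) * R - R..(2 * k + 1) * R + R}" "finite Z" "card Z = M" "\<forall>z\<in>Z. ?h z = 0"
      using zeros unfolding zeros_in_windows_def by blast
    have "m \<le> card (Z - {(k + 1) * (2 * R)})"
      using Z(2,3) by (simp add: m_def card_Diff_singleton_if)
    then obtain Z' where Z': "Z' \<subseteq> Z - {(k + 1) * (2 * R)}" "card Z' = m"
      using obtain_subset_with_card_n by metis
    have "Z' \<subseteq> {k * (2 * R)..<(k + 1) * (2 * R)}"
    proof
      fix z assume "z \<in> Z'"
      with Z' Z(1) have "z \<in> {(2 * k + 1) * R - R..(2 * k + 1) * R + R}" "z \<noteq> (k + 1) * (2 * R)" by auto
      then show "z \<in> {k * (2 * R)..<(k + 1) * (2 * R)}" by (simp add: algebra_simps)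
    qed
    with Z Z' show ?thesis by (intro exI[of _ Z']) (auto intro: finite_subset)
  qed
  then obtain Z where Z: "\<And>k. finite (Z k)" "\<And>k. card (Z k) = m"
      "\<And>k. Z k \<subseteq> {k * (2 * R)..<(k + 1) * (2 * R)}" "\<And>k z. z \<in> Z k \<Longrightarrow> ?h z = 0"
    by metis
  have "F (of_real (exp (2 * \<gamma> * x))) = 0"
  proof (rule holomorphic_zero_if_many_zeros[OF F \<gamma>])
    show "0 < 2 * R" "2 * R < real m" using R m by auto
    show "F (of_real (exp (2 * \<gamma> * z))) = 0" if "z \<in> Z (of_int k)" for k :: int and z
      using hF[of z] Z(4)[OF that] s by simp
  qed (rule growth Z(1-3) | simp)+
  then show "?h x = 0" using hF[of x] by simp
qed

text \<open>Undoing \<open>n\<close> averagings costs at most \<open>n\<close> of the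
  \<open>M + n\<close> zeros, so the normal series still has \<open>M\<close> per window and
  vanishes. Averaging the zero function \<open>n\<close> times returns to the original
  series.\<close>

lemma real_shift_series_gaussian_type_eq_0:
  fixes a :: "int \<Rightarrow> real"
  assumes \<sigma>: "\<sigma> > 0" and a: "\<forall>k. \<bar>a k\<bar> \<le> A"
    and R: "0 < R" "2 * R + 1 < real M"
    and zeros: "zeros_in_windows (M + n) R (real_shift_series (gaussian_type_kernel \<sigma> \<delta> n) a)"
  shows "real_shift_series (gaussian_type_kernel \<sigma> \<delta> n) a x = 0"
proof -
  let ?h = "\<lambda>n. real_shift_series (gaussian_type_kernel \<sigma> \<delta> n) a"
  obtain B where B: "\<And>n. shift_bounded B (gaussian_type_kernel \<sigma> \<delta> n)"
    using shift_bounded_gaussian_type_kernel[OF \<sigma>] by blast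
  have step: "?h (Suc n) = exp_smooth (\<delta> (Suc n)) (?h n)" for n
    using real_shift_series_exp_smooth[OF B a] by simp
  have bnd: "\<bar>?h n x\<bar> \<le> A * B" for n x
    by (rule abs_real_shift_series_le[OF B a])
  have cont: "continuous_on UNIV (?h n)" for n
  proof (induction n)
    case 0
    show ?case using continuous_real_shift_series_normal_density[OF \<sigma> a] by simp
  next
    case (Suc n)
    then show ?case unfolding step by (rule continuous_exp_smooth[OF _ bnd])
  qed
  have "zeros_in_windows (M + n) R (?h n) \<Longrightarrow> zeros_in_windows M R (?h 0)" for n
  proof (induction n)
    case (Suc n)
    have "zeros_in_windows (Suc (M + n)) R (exp_smooth (\<delta> (Suc n)) (?h n))"
      using Suc.prems unfolding step by simp
    from zeros_in_windows_exp_smooth[OF this cont bnd] show ?case by (rule Suc.IH)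
  qed simp
  from this[OF zeros] have 0: "?h 0 x = 0" for x
    using real_shift_series_normal_density_eq_0[OF \<sigma> a R] by simp
  have "?h n = (\<lambda>x. 0)"
  proof (induction n)
    case (Suc n)
    then show ?case unfolding step by (auto simp: exp_smooth_def)
  qed (use 0 in auto)
  then show ?thesis by simp
qed

section \<open>From density to zero counts, and the conclusion\<close>

text \<open>A density above some \<open>r > 1\<close> gives at least \<open>2 * R * r\<close> points
  in every window of large radius \<open>R\<close>. The surplus over \<open>2 * R\<close> grows with
  \<open>R\<close>, so it can absorb any prescribed loss \<open>n\<close>.\<close>

lemma lower_beurling_density_gt_1D:
  assumes "lower_beurling_density N > 1"
  obtains R M where "0 < R" "2 * R + 1 < real M"
    "\<And>x. \<exists>Z\<subseteq>N \<inter> {x - R..x + R}. finite Z \<and> card Z = M + n"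
proof -
  obtain y where y: "1 < y" "y < lower_beurling_density N"
    using dense[OF assms] by blast
  define r where "r = enn2real y"
  have yr: "y = ennreal r"
    using order.strict_trans2[OF y(2) top_greatest] by (simp add: r_def)
  have r: "r > 1" using y(1) ennreal_less_iff[of 1 r] unfolding yr by simp
  have "eventually (\<lambda>R. y < (INF x. emeasure (count_space UNIV) (N \<inter> {x - R..x + R}) / ennreal (2 * R))) at_top"
    using y(2) unfolding lower_beurling_density_def by (rule less_LiminfD)
  \<comment> \<open>Beyond this threshold the surplus \<open>2 * R * (r - 1)\<close> exceeds
    \<open>n + 3\<close>, enough for \<open>n\<close> averagings, the term 1 in the bound on
    \<open>M\<close>, and rounding down.\<close>
  moreover have "eventually (\<lambda>R. (n + 3) / (2 * (r - 1)) < R) at_top"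
    by (rule eventually_gt_at_top)
  moreover have "eventually (\<lambda>R::real. 0 < R) at_top"
    by (rule eventually_gt_at_top)
  ultimately have "eventually (\<lambda>R. y < (INF x. emeasure (count_space UNIV) (N \<inter> {x - R..x + R}) / ennreal (2 * R))
      \<and> (n + 3) / (2 * (r - 1)) < R \<and> 0 < R) at_top"
    by eventually_elim simp
  then obtain R where R: "y < (INF x. emeasure (count_space UNIV) (N \<inter> {x - R..x + R}) / ennreal (2 * R))"
    "(n + 3) / (2 * (r - 1)) < R" "0 < R"
    using eventually_happens[of _ "at_top :: real filter"] by auto
  define K where "K = nat \<lfloor>2 * R * r\<rfloor>"
  have "0 \<le> 2 * R * r" using R r by simp
  then have K: "real K \<le> 2 * R * r" "2 * R * r < real K + 1"
    unfolding K_def by linarith+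
  have "n + 3 < R * (2 * (r - 1))"
    using R(2) r by (simp add: divide_less_eq)
  with K have K': "2 * R + 1 + n < real K" by (simp add: algebra_simps)
  have "\<exists>Z\<subseteq>N \<inter> {x - R..x + R}. finite Z \<and> card Z = K" for x
  proof (cases "finite (N \<inter> {x - R..x + R})")
    case True
    define e where "e = emeasure (count_space UNIV) (N \<inter> {x - R..x + R})"
    have "y < e / ennreal (2 * R)"
      unfolding e_def using R(1) by (rule less_INF_D) simp
    then have "y * ennreal (2 * R) \<le> e / ennreal (2 * R) * ennreal (2 * R)"
      by (intro mult_right_mono) auto
    also have "\<dots> = e"
      using R(3) by (simp add: ennreal_divide_times ennreal_divide_self)
    also have "e = ennreal (real (card (N \<inter> {x - R..x + R})))"
      using True by (simp add: e_def ennreal_of_nat_eq_real_of_nat)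
    finally have "r * (2 * R) \<le> real (card (N \<inter> {x - R..x + R}))"
      using r R(3) by (simp add: yr ennreal_mult[symmetric])
    with K(1) have "K \<le> card (N \<inter> {x - R..x + R})" by (simp add: mult_ac)
    with True show ?thesis
      by (metis obtain_subset_with_card_n finite_subset)
  next
    case False
    then show ?thesis using infinite_arbitrarily_large by blast
  qed
  then show ?thesis
    using K' R(3) by (intro that[of R "K - n"]) (auto simp: of_nat_diff)
qed

theorem theorem1p6:
  fixes g :: "real \<Rightarrow> complex" and c :: "int \<Rightarrow> complex" and f :: "real \<Rightarrow> complex"
  assumes "totally_positive_gaussian_type g"
    and "bounded (range c)"
    and "f = shift_series g c"
  shows "lower_beurling_density {x. f x = 0} \<le> 1 \<or> (\<forall>x. f x = 0)"
proof (cases "lower_beurling_density {x. f x = 0} \<le> 1")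
  case False
  then have dens: "lower_beurling_density {x. f x = 0} > 1" by simp
  obtain \<sigma> \<delta> n where \<sigma>: "\<sigma> > 0" and g: "g = (\<lambda>x. of_real (gaussian_type_kernel \<sigma> \<delta> n x))"
    using gaussian_type_eq_kernel[OF assms(1)] by blast
  obtain B where B: "\<And>n. shift_bounded B (gaussian_type_kernel \<sigma> \<delta> n)"
    using shift_bounded_gaussian_type_kernel[OF \<sigma>] by blast
  obtain A where A: "\<And>k. norm (c k) \<le> A"
    using assms(2) by (auto simp: bounded_iff)
  let ?S = "real_shift_series (gaussian_type_kernel \<sigma> \<delta> n)"
  have bnd: "\<forall>k. \<bar>Re (c k)\<bar> \<le> A" "\<forall>k. \<bar>Im (c k)\<bar> \<le> A"
    using A abs_Re_le_cmod abs_Im_le_cmod order_trans by blast+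
  \<comment> \<open>The kernel is real, so splitting the coefficients splits \<open>f\<close> into
    its real and imaginary parts; each inherits every zero of \<open>f\<close> and is treated
    separately.\<close>
  have f: "f x = Complex (?S (\<lambda>k. Re (c k)) x) (?S (\<lambda>k. Im (c k)) x)" for x
  proof -
    have "((\<lambda>k. Re (c k) * gaussian_type_kernel \<sigma> \<delta> n (x - of_int k)) has_sum ?S (\<lambda>k. Re (c k)) x) UNIV"
         "((\<lambda>k. Im (c k) * gaussian_type_kernel \<sigma> \<delta> n (x - of_int k)) has_sum ?S (\<lambda>k. Im (c k)) x) UNIV"
      unfolding real_shift_series_def
      using abs_summable_summable[OF shift_series_abs_summable[OF B bnd(1)]]
        abs_summable_summable[OF shift_series_abs_summable[OF B bnd(2)]]
      by (auto intro: has_sum_infsum)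
    from has_sum_add[OF has_sum_of_real[OF this(1)] has_sum_cmult_right[OF has_sum_of_real[OF this(2)], of \<i>]]
    have "((\<lambda>k. of_real (Re (c k) * gaussian_type_kernel \<sigma> \<delta> n (x - of_int k))
          + \<i> * of_real (Im (c k) * gaussian_type_kernel \<sigma> \<delta> n (x - of_int k)))
        has_sum (of_real (?S (\<lambda>k. Re (c k)) x) + \<i> * of_real (?S (\<lambda>k. Im (c k)) x))) UNIV" .
    moreover have "of_real (Re (c k) * gaussian_type_kernel \<sigma> \<delta> n (x - of_int k))
          + \<i> * of_real (Im (c k) * gaussian_type_kernel \<sigma> \<delta> n (x - of_int k)) = c k * g (x - of_int k)" for k
      by (simp add: g complex_eq_iff)
    ultimately have "((\<lambda>k. c k * g (x - of_int k)) has_sum Complex (?S (\<lambda>k. Re (c k)) x) (?S (\<lambda>k. Im (c k)) x)) UNIV"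
      by (simp add: Complex_eq)
    then show ?thesis
      unfolding assms(3) shift_series_def by (rule infsumI)
  qed
  obtain R M where R: "0 < R" "2 * R + 1 < real M"
    and Z: "\<And>x. \<exists>Z\<subseteq>{x. f x = 0} \<inter> {x - R..x + R}. finite Z \<and> card Z = M + n"
    using lower_beurling_density_gt_1D[OF dens] by blast
  have "zeros_in_windows (M + n) R (?S (\<lambda>k. Re (c k)))" "zeros_in_windows (M + n) R (?S (\<lambda>k. Im (c k)))"
    unfolding zeros_in_windows_def
  proof (safe)
    fix x
    obtain Z where "Z \<subseteq> {x. f x = 0} \<inter> {x - R..x + R}" "finite Z" "card Z = M + n"
      using Z by blast
    moreover from this have "?S (\<lambda>k. Re (c k)) z = 0" "?S (\<lambda>k. Im (c k)) z = 0" if "z \<in> Z" for z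
      using f[of z] that by (auto simp: complex_eq_iff)
    ultimately show "\<exists>Z\<subseteq>{x - R..x + R}. finite Z \<and> card Z = M + n \<and> (\<forall>z\<in>Z. ?S (\<lambda>k. Re (c k)) z = 0)"
      "\<exists>Z\<subseteq>{x - R..x + R}. finite Z \<and> card Z = M + n \<and> (\<forall>z\<in>Z. ?S (\<lambda>k. Im (c k)) z = 0)"
      by (intro exI[of _ Z]; auto)+
  qed
  then have "\<forall>x. f x = 0"
    using real_shift_series_gaussian_type_eq_0[OF \<sigma> bnd(1) R] real_shift_series_gaussian_type_eq_0[OF \<sigma> bnd(2) R]
    by (simp add: f complex_eq_iff)
  then show ?thesis ..
qed simp

end
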